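(* Let $H=\langle s_1,\dots,s_n\mid R_1,\dots,R_m\rangle$ be a finitely presented group and $G=G(H)$ the Miller group of $H$. Assume that $m>1$. Then the Strong Black Hole $\mathbb{SBH}(G)$ in $G(H)$ is a strongly negligible set and $$f_k(\mathbb{SBH}(G))<\left(\frac{n+1}{n+m}\right)^{k-1}\quad\text{for all }k>1.$$
   Context: The Miller group $G(H)$ is the group with generators $q,\ s_1,\dots,s_n,\ t_1,\dots,t_m,\ d_1,\dots,d_n$ and relations $$t_i^{-1}qt_i=qR_i,\quad t_i^{-1}s_jt_i=s_j,\quad d_j^{-1}qd_j=s_j^{-1}qs_j,\quad d_k^{-1}s_jd_k=s_j$$ ($1\le i\le m$, $1\le j,k\le n$). Put $S=\{s_1,\dots,s_n\}$, $D=\{d_1,\dots,d_n\}$, $T=\{t_1,\dots,t_m\}$; $F(S)$, $F(S,q)$ and $F(T,D)$, the free groups on $S$, $S\cup\{q\}$ and $T\cup D$, are subgroups of $G(H)$, and $F(S,q)$ is normal. Every $g\in G(H)$ is uniquely written as $g=uf$ with $u\in F(T,D)$ and $f\in F(S,q)$; the length of $g$ is $l(g)=|u|+|f|$, where $|u|$, $|f|$ are the lengths of the freely reduced words $u$, $f$ in the free groups $F(T,D)$, $F(S,q)$. To define strongly singular elements, view $G(H)$ as the HNN-extension of $K=F(T,D)\times F(S)$ with stable letter $q$ and associated subgroups $A=\langle t_1,\dots,t_m,s_1d_1^{-1},\dots,s_nd_n^{-1}\rangle$ and $B=\langle t_1R_1^{-1},\dots,t_mR_m^{-1},s_1d_1^{-1},\dots,s_nd_n^{-1}\rangle$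 (with $q^{-1}t_iq=t_iR_i^{-1}$, $q^{-1}s_jd_j^{-1}q=s_jd_j^{-1}$). Let $\lambda(g)$ be the number of occurrences of $q^{\pm1}$ in a reduced form of $g$ for this HNN-extension; $g$ is cyclically reduced if either $\lambda(g)>0$ and $\lambda(g^2)=2\lambda(g)$, or $g\in K$ and $g$ is in $A\cup B$ or is not conjugate in $K$ to any element of $A\cup B$. A cyclically reduced element $g=uf$ is strongly singular if $u=1$. The Strong Black Hole $\mathbb{SBH}(G)$ is the set of all elements of $G(H)$ conjugate to strongly singular elements; it equals $F(S,q)$. Let $G_k$ be the set of elements of $G(H)$ of length $k$ (with respect to $l$). For $R\subseteq G(H)$, $f_k(R)=|R\cap G_k|/|G_k|$. A set $R$ is generic if $\limsup_{k\to\infty}f_k(R)=1$; it is strongly generic if, in addition, there is a positive constant $\delta<1$ such that $1-\delta^k<f_k(R)<1$ for all sufficiently large $k$. A set is strongly negligible if its complement is strongly generic. *)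

theory Defs
  imports "HOL-Algebra.Generated_Groups" "HOL-Algebra.Coset" "HOL-Library.Extended_Real"
begin

text \<open>The letter \<open>(x, True)\<close> stands for \<open>x\<close> and \<open>(x, False)\<close> for its formal inverse.\<close>

type_synonym 'a letters = "('a \<times> bool) list"

abbreviation pos :: "'a \<Rightarrow> 'a \<times> bool" where "pos x \<equiv> (x, True)"
abbreviation neg :: "'a \<Rightarrow> 'a \<times> bool" where "neg x \<equiv> (x, False)"

definition inv_letter :: "'a \<times> bool \<Rightarrow> 'a \<times> bool" where
  "inv_letter a = (fst a, \<not> snd a)"

definition inv_word :: "'a letters \<Rightarrow> 'a letters" where
  "inv_word w = rev (map inv_letter w)"

definition words :: "'a set \<Rightarrow> 'a letters set" where
  "words X = lists (X \<times> UNIV)"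

definition freely_reduced :: "'a letters \<Rightarrow> bool" where
  "freely_reduced w \<longleftrightarrow> successively (\<lambda>a b. b \<noteq> inv_letter a) w"

fun cancel_cons :: "'a \<times> bool \<Rightarrow> 'a letters \<Rightarrow> 'a letters" where
  "cancel_cons a [] = [a]"
| "cancel_cons a (b # w) = (if b = inv_letter a then w else a # b # w)"

definition reduce :: "'a letters \<Rightarrow> 'a letters" where
  "reduce w = foldr cancel_cons w []"

definition free_group :: "'a set \<Rightarrow> 'a letters monoid" where
  "free_group X = \<lparr>carrier = {w \<in> words X. freely_reduced w},
                   monoid.mult = (\<lambda>u v. reduce (u @ v)),
                   one = []\<rparr>"

definition normal_closure :: "('g, 'b) monoid_scheme \<Rightarrow> 'g set \<Rightarrow> 'g set" where
  "normal_closure F A =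
     generate F {g \<otimes>\<^bsub>F\<^esub> a \<otimes>\<^bsub>F\<^esub> inv\<^bsub>F\<^esub> g | g a. g \<in> carrier F \<and> a \<in> A}"

text \<open>A relation \<open>u = v\<close> is a pair \<open>(u, v)\<close> of words, which contributes the relator \<open>u v\<^sup>-\<^sup>1\<close>.\<close>

definition relators_closure :: "'a set \<Rightarrow> ('a letters \<times> 'a letters) set \<Rightarrow> 'a letters set" where
  "relators_closure X E =
     normal_closure (free_group X) {reduce (u @ inv_word v) | u v. (u, v) \<in> E}"

definition presented_group :: "'a set \<Rightarrow> ('a letters \<times> 'a letters) set \<Rightarrow> 'a letters set monoid" where
  "presented_group X E = free_group X Mod relators_closure X E"

definition word_class ::
    "'a set \<Rightarrow> ('a letters \<times> 'a letters) set \<Rightarrow> 'a letters \<Rightarrow> 'a letters set" where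
  "word_class X E w = relators_closure X E #>\<^bsub>free_group X\<^esub> reduce w"

text \<open>
  Here \<open>G\<close> is a group that is an HNN-extension of its subgroup \<open>K\<close> with stable letter \<open>q\<close> and
  associated subgroups \<open>A\<close>, \<open>B\<close>, where \<open>q\<^sup>-\<^sup>1 A q = B\<close>. The data \<open>k\<^sub>0\<close>,
  \<open>[(\<epsilon>\<^sub>1, k\<^sub>1), \<dots>, (\<epsilon>\<^sub>r, k\<^sub>r)]\<close> encode the word
  \<open>k\<^sub>0 q^\<epsilon>\<^sub>1 k\<^sub>1 \<dots> q^\<epsilon>\<^sub>r k\<^sub>r\<close>. It is reduced if it contains no subword \<open>q\<^sup>-\<^sup>1 a q\<close> with
  \<open>a \<in> A\<close> and no subword \<open>q b q\<^sup>-\<^sup>1\<close> with \<open>b \<in> B\<close>.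
\<close>

definition hnn_value :: "('g, 'b) monoid_scheme \<Rightarrow> 'g \<Rightarrow> 'g \<Rightarrow> (int \<times> 'g) list \<Rightarrow> 'g" where
  "hnn_value G q k\<^sub>0 ps =
     k\<^sub>0 \<otimes>\<^bsub>G\<^esub> foldr (\<lambda>(e, k) x. q [^]\<^bsub>G\<^esub> e \<otimes>\<^bsub>G\<^esub> k \<otimes>\<^bsub>G\<^esub> x) ps \<one>\<^bsub>G\<^esub>"

definition hnn_reduced :: "'g set \<Rightarrow> 'g set \<Rightarrow> 'g set \<Rightarrow> 'g \<Rightarrow> (int \<times> 'g) list \<Rightarrow> bool" where
  "hnn_reduced K A B k\<^sub>0 ps \<longleftrightarrow>
     k\<^sub>0 \<in> K \<and> (\<forall>(e, k) \<in> set ps. e \<in> {1, -1} \<and> k \<in> K) \<and>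
     successively (\<lambda>(e, k) (e', k').
        \<not> (e = -1 \<and> k \<in> A \<and> e' = 1) \<and> \<not> (e = 1 \<and> k \<in> B \<and> e' = -1)) ps"

text \<open>All reduced forms of an element have the same number of stable letters.\<close>

definition hnn_length ::
    "('g, 'b) monoid_scheme \<Rightarrow> 'g set \<Rightarrow> 'g set \<Rightarrow> 'g set \<Rightarrow> 'g \<Rightarrow> 'g \<Rightarrow> nat" where
  "hnn_length G K A B q g =
     (THE r. \<exists>k\<^sub>0 ps. hnn_reduced K A B k\<^sub>0 ps \<and> hnn_value G q k\<^sub>0 ps = g \<and> length ps = r)"

definition hnn_cyclically_reduced ::
    "('g, 'b) monoid_scheme \<Rightarrow> 'g set \<Rightarrow> 'g set \<Rightarrow> 'g set \<Rightarrow> 'g \<Rightarrow> 'g \<Rightarrow> bool" where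
  "hnn_cyclically_reduced G K A B q g \<longleftrightarrow>
     g \<in> carrier G \<and>
     (hnn_length G K A B q g > 0 \<and>
        hnn_length G K A B q (g \<otimes>\<^bsub>G\<^esub> g) = 2 * hnn_length G K A B q g
      \<or> g \<in> K \<and> (g \<in> A \<union> B \<or> \<not> (\<exists>k \<in> K. k \<otimes>\<^bsub>G\<^esub> g \<otimes>\<^bsub>G\<^esub> inv\<^bsub>G\<^esub> k \<in> A \<union> B)))"

definition sphere :: "('g, 'b) monoid_scheme \<Rightarrow> ('g \<Rightarrow> nat) \<Rightarrow> nat \<Rightarrow> 'g set" where
  "sphere G l k = {g \<in> carrier G. l g = k}"

definition frequency ::
    "('g, 'b) monoid_scheme \<Rightarrow> ('g \<Rightarrow> nat) \<Rightarrow> 'g set \<Rightarrow> nat \<Rightarrow> real" where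
  "frequency G l R k = real (card (R \<inter> sphere G l k)) / real (card (sphere G l k))"

definition generic_set :: "('g, 'b) monoid_scheme \<Rightarrow> ('g \<Rightarrow> nat) \<Rightarrow> 'g set \<Rightarrow> bool" where
  "generic_set G l R \<longleftrightarrow> limsup (\<lambda>k. ereal (frequency G l R k)) = 1"

definition strongly_generic :: "('g, 'b) monoid_scheme \<Rightarrow> ('g \<Rightarrow> nat) \<Rightarrow> 'g set \<Rightarrow> bool" where
  "strongly_generic G l R \<longleftrightarrow>
     generic_set G l R \<and>
     (\<exists>\<delta>::real. 0 < \<delta> \<and> \<delta> < 1 \<and>
        (\<forall>\<^sub>F k in sequentially. 1 - \<delta> ^ k < frequency G l R k \<and> frequency G l R k < 1))"

definition strongly_negligible :: "('g, 'b) monoid_scheme \<Rightarrow> ('g \<Rightarrow> nat) \<Rightarrow> 'g set \<Rightarrow> bool" where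
  "strongly_negligible G l R \<longleftrightarrow> strongly_generic G l (carrier G - R)"

datatype miller_gen = Gq | Gs nat | Gt nat | Gd nat

text \<open>
  The Miller group depends on the given presentation of \<open>H = \<langle>s\<^sub>1, \<dots>, s\<^sub>n | R\<^sub>1, \<dots>, R\<^sub>m\<rangle>\<close>:
  \<open>R i\<close>, for \<open>1 \<le> i \<le> m\<close>, is a word over \<open>{1..n}\<close>, where \<open>j\<close> stands for \<open>s\<^sub>j\<close>.
\<close>

definition finite_presentation :: "nat \<Rightarrow> nat \<Rightarrow> (nat \<Rightarrow> nat letters) \<Rightarrow> bool" where
  "finite_presentation n m R \<longleftrightarrow> (\<forall>i \<in> {1..m}. R i \<in> words {1..n})"

context
  fixes n m :: nat and R :: "nat \<Rightarrow> nat letters"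
begin

definition s_word :: "nat \<Rightarrow> miller_gen letters" where
  "s_word i = map (map_prod Gs id) (R i)"

definition miller_gens :: "miller_gen set" where
  "miller_gens = {Gq} \<union> Gs ` {1..n} \<union> Gt ` {1..m} \<union> Gd ` {1..n}"

definition miller_relations :: "(miller_gen letters \<times> miller_gen letters) set" where
  "miller_relations =
     {([neg (Gt i), pos Gq, pos (Gt i)], pos Gq # s_word i) | i. i \<in> {1..m}} \<union>
     {([neg (Gt i), pos (Gs j), pos (Gt i)], [pos (Gs j)]) | i j. i \<in> {1..m} \<and> j \<in> {1..n}} \<union>
     {([neg (Gd j), pos Gq, pos (Gd j)], [neg (Gs j), pos Gq, pos (Gs j)]) | j. j \<in> {1..n}} \<union>
     {([neg (Gd k), pos (Gs j), pos (Gd k)], [pos (Gs j)]) | j k. j \<in> {1..n} \<and> k \<in> {1..n}}"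

definition miller_group :: "miller_gen letters set monoid" where
  "miller_group = presented_group miller_gens miller_relations"

definition miller_elt :: "miller_gen letters \<Rightarrow> miller_gen letters set" where
  "miller_elt w = word_class miller_gens miller_relations w"

definition gens_S :: "miller_gen set" where
  "gens_S = Gs ` {1..n}"

definition gens_Sq :: "miller_gen set" where
  "gens_Sq = insert Gq gens_S"

definition gens_TD :: "miller_gen set" where
  "gens_TD = Gt ` {1..m} \<union> Gd ` {1..n}"

definition subgroup_of_gens :: "miller_gen set \<Rightarrow> miller_gen letters set set" where
  "subgroup_of_gens Y = generate miller_group ((\<lambda>y. miller_elt [pos y]) ` Y)"

definition F_Sq :: "miller_gen letters set set" where
  "F_Sq = subgroup_of_gens gens_Sq"

definition F_TD :: "miller_gen letters set set" where
  "F_TD = subgroup_of_gens gens_TD"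

text \<open>
  For \<open>Y\<close> freely generating \<open>subgroup_of_gens Y\<close>: the length of the freely reduced word over \<open>Y\<close>
  that represents a given element.
\<close>

definition free_length :: "miller_gen set \<Rightarrow> miller_gen letters set \<Rightarrow> nat" where
  "free_length Y g = (THE r. \<exists>w \<in> words Y. freely_reduced w \<and> miller_elt w = g \<and> length w = r)"

text \<open>The decomposition \<open>g = u f\<close> is unique.\<close>

definition miller_length :: "miller_gen letters set \<Rightarrow> nat" where
  "miller_length g = (THE r. \<exists>u \<in> F_TD. \<exists>f \<in> F_Sq.
     g = u \<otimes>\<^bsub>miller_group\<^esub> f \<and> r = free_length gens_TD u + free_length gens_Sq f)"

text \<open>\<open>F(T,D) \<times> F(S)\<close> as an internal direct product.\<close>

definition hnn_base :: "miller_gen letters set set" where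
  "hnn_base = subgroup_of_gens (gens_TD \<union> gens_S)"

definition hnn_A :: "miller_gen letters set set" where
  "hnn_A = generate miller_group
     ({miller_elt [pos (Gt i)] | i. i \<in> {1..m}} \<union>
      {miller_elt [pos (Gs j), neg (Gd j)] | j. j \<in> {1..n}})"

definition hnn_B :: "miller_gen letters set set" where
  "hnn_B = generate miller_group
     ({miller_elt (pos (Gt i) # inv_word (s_word i)) | i. i \<in> {1..m}} \<union>
      {miller_elt [pos (Gs j), neg (Gd j)] | j. j \<in> {1..n}})"

definition cyclically_reduced :: "miller_gen letters set \<Rightarrow> bool" where
  "cyclically_reduced g \<longleftrightarrow>
     hnn_cyclically_reduced miller_group hnn_base hnn_A hnn_B (miller_elt [pos Gq]) g"

definition strongly_singular :: "miller_gen letters set \<Rightarrow> bool" where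
  "strongly_singular g \<longleftrightarrow> cyclically_reduced g \<and>
     (\<exists>u \<in> F_TD. \<exists>f \<in> F_Sq. g = u \<otimes>\<^bsub>miller_group\<^esub> f \<and> u = \<one>\<^bsub>miller_group\<^esub>)"

definition strong_black_hole :: "miller_gen letters set set" where
  "strong_black_hole =
     {x \<otimes>\<^bsub>miller_group\<^esub> g \<otimes>\<^bsub>miller_group\<^esub> inv\<^bsub>miller_group\<^esub> x | x g.
        x \<in> carrier miller_group \<and> strongly_singular g}"

end

end

theory Submission
  imports Defs
begin

text \<open>
  Each defining relation of the Miller group prescribes how a letter \<open>t\<^sub>i\<close> or \<open>d\<^sub>j\<close> conjugates a
  generator of \<open>F(S, q)\<close>, and the prescribed maps are automorphisms of the free group \<open>F(S, q)\<close>. So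
  \<open>G(H)\<close> is the semidirect product of the normal subgroup \<open>F(S, q)\<close>, free of rank \<open>p = n + 1\<close>, and of
  \<open>F(T, D)\<close>, free of rank \<open>r = n + m\<close>. The uniqueness of the decomposition \<open>g = u f\<close> is obtained by
  letting the group act on the pairs of reduced words \<open>(u, f)\<close> by right multiplication
  (\<open>fold_nf_act_relation\<close>, \<open>bij_betw_normal_form\<close>); consequently the length of \<open>g\<close> is
  \<open>|u| + |f|\<close>, and its spheres are counted by reduced words.

  A strongly singular element lies in \<open>F(S, q)\<close>, and so do its conjugates
  (\<open>strong_black_hole_subset\<close>). Thus the Strong Black Hole has at most \<open>2p (2p - 1)\<^sup>k\<^sup>-\<^sup>1\<close> elements of
  length \<open>k\<close>, while the sphere of \<open>G(H)\<close> has more than \<open>2r (2r - 1)\<^sup>k\<^sup>-\<^sup>1\<close>. As \<open>m > 1\<close> means \<open>p < r\<close>, the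
  frequency is less than \<open>(p/r)\<^sup>k\<close> (\<open>frequency_strong_black_hole\<close>). This gives the claimed bound, and
  \<open>\<delta> = p/r\<close> serves for strong genericity of the complement.

  Strong genericity also demands that the frequency of the complement is less than 1, that is, that
  the Strong Black Hole meets every large sphere (\<open>strong_black_hole_Int_sphere_nonempty\<close>). If
  \<open>n > 0\<close>, it contains the powers \<open>s\<^sub>1\<^sup>k\<close>: they lie in the base of the HNN-extension, and no nontrivial
  element of \<open>F(S, q)\<close> lies in \<open>A\<close> or \<open>B\<close>, because both of these project injectively to \<open>F(T, D)\<close>.
  If \<open>n = 0\<close>, then \<open>A\<close> and \<open>B\<close> are the whole base, so that \<open>\<lambda>\<close> is the absolute value of the
  exponent sum of \<open>q\<close>, and the powers \<open>q\<^sup>k\<close> are cyclically reduced.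
\<close>

section \<open>Free reduction\<close>

lemma inv_letter_simps [simp]:
  "inv_letter (inv_letter a) = a" "fst (inv_letter a) = fst a" "inv_letter a \<noteq> a"
  "inv_letter (x, b) = (x, \<not> b)"
  by (auto simp: inv_letter_def prod_eq_iff)

lemma inv_word_simps [simp]:
  "inv_word [] = []" "inv_word (a # w) = inv_word w @ [inv_letter a]"
  "inv_word (u @ v) = inv_word v @ inv_word u" "inv_word (inv_word w) = w"
  by (auto simp: inv_word_def rev_map comp_def)

lemma in_words_iff: "w \<in> words X \<longleftrightarrow> (\<forall>a \<in> set w. fst a \<in> X)"
  by (auto simp: words_def)

lemma words_simps [simp]:
  "[] \<in> words X" "a # w \<in> words X \<longleftrightarrow> fst a \<in> X \<and> w \<in> words X"
  "u @ v \<in> words X \<longleftrightarrow> u \<in> words X \<and> v \<in> words X"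
  "inv_word w \<in> words X \<longleftrightarrow> w \<in> words X"
  by (auto simp: in_words_iff inv_word_def)

lemma words_mono: "X \<subseteq> Y \<Longrightarrow> w \<in> words X \<Longrightarrow> w \<in> words Y"
  by (auto simp: in_words_iff)

lemma freely_reduced_simps [simp]:
  "freely_reduced []" "freely_reduced [a]"
  "freely_reduced (a # b # w) \<longleftrightarrow> b \<noteq> inv_letter a \<and> freely_reduced (b # w)"
  by (auto simp: freely_reduced_def)

lemma freely_reduced_ConsD: "freely_reduced (a # w) \<Longrightarrow> freely_reduced w"
  by (cases w) auto

lemma freely_reduced_cancel_cons: "freely_reduced w \<Longrightarrow> freely_reduced (cancel_cons a w)"
  by (cases w) (auto dest: freely_reduced_ConsD)

lemma cancel_cons_id: "freely_reduced (a # w) \<Longrightarrow> cancel_cons a w = a # w"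
  by (cases w) auto

text \<open>
  Cancelling letters act on the reduced words as permutations. Hence the action of a word on a
  reduced word depends only on the reduced form of the acting word, which makes concatenation
  followed by reduction associative.
\<close>

lemma cancel_cons_inverse:
  "freely_reduced w \<Longrightarrow> cancel_cons a (cancel_cons (inv_letter a) w) = w"
  by (cases w) (auto simp: cancel_cons_id)

lemma reduce_simps [simp]: "reduce [] = []" "reduce (a # w) = cancel_cons a (reduce w)"
  by (simp_all add: reduce_def)

lemma freely_reduced_reduce [simp]: "freely_reduced (reduce w)"
  by (induction w) (auto simp: freely_reduced_cancel_cons)

lemma reduce_id: "freely_reduced w \<Longrightarrow> reduce w = w"
proof (induction w)
  case (Cons a w)
  then show ?case using freely_reduced_ConsD[OF Cons.prems] by (simp add: cancel_cons_id)
qed simp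

lemma reduce_reduce [simp]: "reduce (reduce w) = reduce w"
  by (simp add: reduce_id)

lemma reduce_in_words: "w \<in> words X \<Longrightarrow> reduce w \<in> words X"
proof (induction w)
  case (Cons a w)
  then show ?case by (cases "reduce w") auto
qed simp

lemma reduce_append: "reduce (u @ v) = foldr cancel_cons u (reduce v)"
  by (simp add: reduce_def)

lemma freely_reduced_foldr_cancel_cons:
  "freely_reduced w \<Longrightarrow> freely_reduced (foldr cancel_cons u w)"
  by (induction u) (auto simp: freely_reduced_cancel_cons)

lemma foldr_cancel_cons_cancel_cons:
  assumes "freely_reduced w"
  shows "foldr cancel_cons (cancel_cons a u) w = cancel_cons a (foldr cancel_cons u w)"
  using assms
  by (cases u) (auto simp: cancel_cons_inverse freely_reduced_foldr_cancel_cons)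

lemma foldr_cancel_cons_reduce:
  "freely_reduced w \<Longrightarrow> foldr cancel_cons (reduce u) w = foldr cancel_cons u w"
  by (induction u) (auto simp: foldr_cancel_cons_cancel_cons)

lemma reduce_append_reduce [simp]:
  "reduce (reduce u @ v) = reduce (u @ v)" "reduce (u @ reduce v) = reduce (u @ v)"
  "reduce (u @ reduce v @ w) = reduce (u @ v @ w)"
  by (simp_all add: reduce_append foldr_cancel_cons_reduce)

text \<open>
  Words with the same reduced form represent the same element of the free group; this rule
  multiplies such equalities.
\<close>

lemma reduce_append_cong:
  "reduce u = reduce u' \<Longrightarrow> reduce v = reduce v' \<Longrightarrow> reduce (u @ v) = reduce (u' @ v')"
  by (metis reduce_append_reduce(1,2))

lemma reduce_inverse [simp]:
  "reduce (w @ inv_word w) = []" "reduce (inv_word w @ w) = []"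
proof -
  have right: "reduce (v @ inv_word v) = []" for v :: "'a letters"
  proof (induction v)
    case (Cons a v)
    have "reduce ([a] @ (v @ inv_word v) @ [inv_letter a]) = reduce ([a] @ [] @ [inv_letter a])"
      using Cons by (intro reduce_append_cong) simp_all
    then show ?case by simp
  qed simp
  show "reduce (w @ inv_word w) = []" "reduce (inv_word w @ w) = []"
    using right[of w] right[of "inv_word w"] by simp_all
qed

lemma reduce_cancel_middle [simp]:
  "reduce (u @ w @ inv_word w @ v) = reduce (u @ v)"
  "reduce (u @ inv_word w @ w @ v) = reduce (u @ v)"
proof -
  have *: "reduce (u @ z @ v) = reduce (u @ v)" if "reduce z = []" for z
    using reduce_append_cong[OF refl reduce_append_cong[OF _ refl], of z "[]" u v] that by simp
  show "reduce (u @ w @ inv_word w @ v) = reduce (u @ v)"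
    "reduce (u @ inv_word w @ w @ v) = reduce (u @ v)"
    using *[of "w @ inv_word w"] *[of "inv_word w @ w"] by simp_all
qed

lemma reduce_inv_word_cong:
  assumes "reduce u = reduce v"
  shows "reduce (inv_word u) = reduce (inv_word v)"
proof -
  have "reduce (inv_word u) = reduce (inv_word u @ v @ inv_word v)"
    using reduce_cancel_middle(1)[of "inv_word u" v "[]"] by simp
  also have "\<dots> = reduce (inv_word u @ u @ inv_word v)"
    using assms by (intro reduce_append_cong) simp_all
  also have "\<dots> = reduce (inv_word v)"
    using reduce_cancel_middle(2)[of "[]" u "inv_word v"] by simp
  finally show ?thesis .
qed

text \<open>
  On words, the homomorphism of free groups that sends each generator \<open>x\<close> to \<open>\<sigma> x\<close>.
\<close>

definition word_subst :: "('b \<Rightarrow> 'a letters) \<Rightarrow> 'b letters \<Rightarrow> 'a letters" where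
  "word_subst \<sigma> w = concat (map (\<lambda>(x, b). if b then \<sigma> x else inv_word (\<sigma> x)) w)"

lemma word_subst_simps [simp]:
  "word_subst \<sigma> [] = []"
  "word_subst \<sigma> ((x, b) # w) = (if b then \<sigma> x else inv_word (\<sigma> x)) @ word_subst \<sigma> w"
  "word_subst \<sigma> (u @ v) = word_subst \<sigma> u @ word_subst \<sigma> v"
  by (auto simp: word_subst_def)

lemma word_subst_inv_word: "word_subst \<sigma> (inv_word w) = inv_word (word_subst \<sigma> w)"
  by (induction w) auto

lemma word_subst_word_subst:
  "word_subst \<tau> (word_subst \<sigma> w) = word_subst (\<lambda>x. word_subst \<tau> (\<sigma> x)) w"
  by (induction w) (auto simp: word_subst_inv_word)

lemma word_subst_in_words:
  "w \<in> words Y \<Longrightarrow> (\<And>y. y \<in> Y \<Longrightarrow> \<sigma> y \<in> words X) \<Longrightarrow> word_subst \<sigma> w \<in> words X"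
  by (induction w) auto

lemma word_subst_pos: "(\<And>x. x \<in> X \<Longrightarrow> \<sigma> x = [pos x]) \<Longrightarrow> w \<in> words X \<Longrightarrow> word_subst \<sigma> w = w"
  by (induction w) auto

lemma reduce_word_subst [simp]: "reduce (word_subst \<sigma> (reduce w)) = reduce (word_subst \<sigma> w)"
proof (induction w)
  case (Cons a w)
  let ?g = "word_subst \<sigma> [a]"
  have "reduce (word_subst \<sigma> (cancel_cons a (reduce w))) = reduce (?g @ word_subst \<sigma> (reduce w))"
  proof (cases "reduce w")
    case Nil
    then show ?thesis by (cases a) simp
  next
    case (Cons b v)
    show ?thesis
    proof (cases "b = inv_letter a")
      case True
      have "word_subst \<sigma> (b # v) = inv_word ?g @ word_subst \<sigma> v"
        using True by (cases a) auto
      then show ?thesis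
        using Cons True reduce_cancel_middle(1)[of "[]" ?g "word_subst \<sigma> v"] by simp
    qed (use Cons in \<open>cases a, simp\<close>)
  qed
  also have "\<dots> = reduce (?g @ word_subst \<sigma> w)"
    using Cons by (intro reduce_append_cong) simp_all
  finally show ?case by (cases a) simp
qed simp

lemma reduce_word_subst_cong:
  assumes "\<And>x. x \<in> X \<Longrightarrow> reduce (\<sigma> x) = reduce (\<tau> x)" and "w \<in> words X"
  shows "reduce (word_subst \<sigma> w) = reduce (word_subst \<tau> w)"
  using assms(2)
proof (induction w)
  case (Cons a w)
  then show ?case
    using assms(1)[of "fst a"]
    by (cases a) (auto intro!: reduce_append_cong reduce_inv_word_cong)
qed simp


section \<open>Counting freely reduced words\<close>

definition reduced_words :: "'a set \<Rightarrow> 'a letters set" where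
  "reduced_words X = {w \<in> words X. freely_reduced w}"

lemma reduce_in_reduced_words: "w \<in> words X \<Longrightarrow> reduce w \<in> reduced_words X"
  by (simp add: reduced_words_def reduce_in_words)

definition reduced_words_of_length :: "'a set \<Rightarrow> nat \<Rightarrow> 'a letters set" where
  "reduced_words_of_length X k = {w \<in> reduced_words X. length w = k}"

lemma finite_reduced_words_of_length:
  assumes "finite X"
  shows "finite (reduced_words_of_length X k)"
proof (rule finite_subset)
  show "reduced_words_of_length X k \<subseteq> {w. set w \<subseteq> X \<times> UNIV \<and> length w = k}"
    by (auto simp: reduced_words_of_length_def reduced_words_def in_words_iff)
  show "finite {w. set w \<subseteq> X \<times> (UNIV :: bool set) \<and> length w = k}"
    using assms by (intro finite_lists_length_eq) auto
qed

text \<open>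
  The first letter of a nonempty reduced word is arbitrary, and a reduced word can be extended on
  the left by every letter except the inverse of its first one.
\<close>

lemma card_reduced_words_of_length:
  fixes X :: "'a set"
  assumes "finite X"
  shows "card (reduced_words_of_length X (Suc k)) = 2 * card X * (2 * card X - 1) ^ k"
proof (induction k)
  case 0
  have "reduced_words_of_length X (Suc 0) = (\<lambda>a. [a]) ` (X \<times> UNIV)"
    by (auto simp: reduced_words_of_length_def reduced_words_def length_Suc_conv)
  then show ?case
    by (simp add: card_image inj_on_def card_cartesian_product)
next
  case (Suc k)
  let ?W = "reduced_words_of_length X (Suc k)"
  let ?E = "\<lambda>w :: 'a letters. X \<times> UNIV - {inv_letter (hd w)}"
  have split: "reduced_words_of_length X (Suc (Suc k)) = (\<lambda>(w, a). a # w) ` (SIGMA w : ?W. ?E w)"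
    (is "?L = ?R")
  proof
    show "?L \<subseteq> ?R"
    proof
      fix w assume "w \<in> ?L"
      then obtain a b v where "w = a # b # v" "a # b # v \<in> ?L"
        by (auto simp: reduced_words_of_length_def length_Suc_conv)
      then show "w \<in> ?R"
        by (intro image_eqI[of _ _ "(b # v, a)"])
          (auto simp: reduced_words_of_length_def reduced_words_def mem_Times_iff)
    qed
    show "?R \<subseteq> ?L"
      by (auto simp: reduced_words_of_length_def reduced_words_def length_Suc_conv)
  qed
  have E: "card (?E w) = 2 * card X - 1" if "w \<in> ?W" for w
  proof -
    have "inv_letter (hd w) \<in> X \<times> UNIV"
      using that
      by (auto simp: reduced_words_of_length_def reduced_words_def length_Suc_conv mem_Times_iff)
    then show ?thesis
      by (simp add: card_Diff_singleton card_cartesian_product)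
  qed
  have "card (reduced_words_of_length X (Suc (Suc k))) = card (SIGMA w : ?W. ?E w)"
    unfolding split by (intro card_image) (auto simp: inj_on_def)
  also have "\<dots> = (\<Sum>w \<in> ?W. card (?E w))"
    using assms by (intro card_SigmaI) (auto simp: finite_reduced_words_of_length)
  also have "\<dots> = card ?W * (2 * card X - 1)"
    using E by simp
  finally show ?case
    using Suc by (simp add: algebra_simps)
qed

lemma Nil_in_reduced_words [simp]: "[] \<in> reduced_words X"
  by (simp add: reduced_words_def)

lemma reduced_words_in_words [simp]: "w \<in> reduced_words X \<Longrightarrow> w \<in> words X"
  by (simp add: reduced_words_def)

lemma reduced_words_reduce [simp]: "w \<in> reduced_words X \<Longrightarrow> reduce w = w"
  unfolding reduced_words_def by (simp add: reduce_id)

section \<open>Free groups and presented groups\<close>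

lemma free_group_simps [simp]:
  "carrier (free_group X) = reduced_words X"
  "u \<otimes>\<^bsub>free_group X\<^esub> v = reduce (u @ v)" "\<one>\<^bsub>free_group X\<^esub> = []"
  unfolding free_group_def reduced_words_def by simp_all

lemma group_free_group: "group (free_group X)"
proof (rule groupI)
  fix u assume u: "u \<in> carrier (free_group X)"
  show "\<exists>v \<in> carrier (free_group X). v \<otimes>\<^bsub>free_group X\<^esub> u = \<one>\<^bsub>free_group X\<^esub>"
    using u by (intro bexI[of _ "reduce (inv_word u)"]) (auto simp: reduce_in_reduced_words)
qed (auto simp: reduce_in_reduced_words)

lemma inv_free_group: "u \<in> reduced_words X \<Longrightarrow> inv\<^bsub>free_group X\<^esub> u = reduce (inv_word u)"
  by (rule group.inv_equality[OF group_free_group]) (auto simp: reduce_in_reduced_words)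

locale presentation =
  fixes X :: "'a set" and E :: "('a letters \<times> 'a letters) set"
  assumes relations_in_words: "E \<subseteq> words X \<times> words X"
begin

text \<open>
  The generating set in the definition of the normal closure, with the operations of the free group
  written out as one reduction.
\<close>

definition conjugated_relators :: "'a letters set" where
  "conjugated_relators = {reduce (g @ u @ inv_word v @ inv_word g) | g u v.
     g \<in> reduced_words X \<and> (u, v) \<in> E}"

lemma relators_closure_eq: "relators_closure X E = generate (free_group X) conjugated_relators"
proof -
  have "{g \<otimes>\<^bsub>free_group X\<^esub> a \<otimes>\<^bsub>free_group X\<^esub> inv\<^bsub>free_group X\<^esub> g | g a.
      g \<in> carrier (free_group X) \<and> a \<in> {reduce (u @ inv_word v) | u v. (u, v) \<in> E}}
    = {g \<otimes>\<^bsub>free_group X\<^esub> reduce (u @ inv_word v) \<otimes>\<^bsub>free_group X\<^esub> inv\<^bsub>free_group X\<^esub> g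
        | g u v. g \<in> reduced_words X \<and> (u, v) \<in> E}"
    unfolding free_group_simps(1) by blast
  also have "\<dots> = conjugated_relators"
  proof -
    have "g \<otimes>\<^bsub>free_group X\<^esub> reduce (u @ inv_word v) \<otimes>\<^bsub>free_group X\<^esub> inv\<^bsub>free_group X\<^esub> g
        = reduce (g @ u @ inv_word v @ inv_word g)" if "g \<in> reduced_words X" for g u v
      using that by (simp add: inv_free_group)
    then show ?thesis
      unfolding conjugated_relators_def by (intro Collect_cong) metis
  qed
  finally show ?thesis
    by (simp add: relators_closure_def normal_closure_def)
qed

lemma conjugated_relators_subset: "conjugated_relators \<subseteq> reduced_words X"
  using relations_in_words
  by (force simp: conjugated_relators_def intro!: reduce_in_reduced_words)

lemma relators_closure_normal: "relators_closure X E \<lhd> free_group X"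
  unfolding relators_closure_eq
proof (rule group.normal_generateI[OF group_free_group])
  show "conjugated_relators \<subseteq> carrier (free_group X)"
    using conjugated_relators_subset by simp
next
  fix h g assume h: "h \<in> conjugated_relators" and g: "g \<in> carrier (free_group X)"
  obtain g' u v where h_eq: "h = reduce (g' @ u @ inv_word v @ inv_word g')"
    and g': "g' \<in> reduced_words X" and "(u, v) \<in> E"
    using h by (auto simp: conjugated_relators_def)
  have "reduce (g @ h @ inv_word g)
      = reduce (reduce (g @ g') @ (u @ inv_word v) @ inv_word (reduce (g @ g')))"
  proof -
    have "reduce (reduce (g @ g') @ (u @ inv_word v) @ inv_word (reduce (g @ g')))
        = reduce ((g @ g') @ (u @ inv_word v) @ inv_word (g @ g'))"
      by (intro reduce_append_cong reduce_inv_word_cong) simp_all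
    moreover have "reduce (g @ h @ inv_word g)
        = reduce (g @ (g' @ u @ inv_word v @ inv_word g') @ inv_word g)"
      unfolding h_eq by (intro reduce_append_cong) simp_all
    ultimately show ?thesis by simp
  qed
  moreover have "reduce (g @ g') \<in> reduced_words X"
    using g g' by (auto intro!: reduce_in_reduced_words)
  ultimately have "reduce (g @ h @ inv_word g) \<in> conjugated_relators"
    using \<open>(u, v) \<in> E\<close> unfolding conjugated_relators_def append_assoc by blast
  then show "g \<otimes>\<^bsub>free_group X\<^esub> h \<otimes>\<^bsub>free_group X\<^esub> inv\<^bsub>free_group X\<^esub> g \<in> conjugated_relators"
    using g by (simp add: inv_free_group)
qed

abbreviation "P \<equiv> presented_group X E"
abbreviation cls :: "'a letters \<Rightarrow> 'a letters set" where "cls \<equiv> word_class X E"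

lemma group_presented: "group P"
  unfolding presented_group_def by (rule normal.factorgroup_is_group[OF relators_closure_normal])

lemma word_class_cong: "reduce u = reduce v \<Longrightarrow> cls u = cls v"
  by (simp add: word_class_def)

lemma word_class_reduce [simp]: "cls (reduce w) = cls w"
  by (simp add: word_class_def)

lemma carrier_presented: "carrier P = cls ` words X"
proof -
  have "carrier P = cls ` reduced_words X"
    unfolding presented_group_def carrier_FactGroup free_group_simps
    by (intro image_cong) (simp_all add: word_class_def)
  also have "\<dots> = cls ` words X"
  proof
    show "cls ` words X \<subseteq> cls ` reduced_words X"
    proof
      fix g assume "g \<in> cls ` words X"
      then obtain w where "w \<in> words X" "g = cls w" by auto
      then show "g \<in> cls ` reduced_words X"
        by (intro image_eqI[of _ _ "reduce w"]) (simp_all add: reduce_in_reduced_words)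
    qed
  qed (intro image_mono subsetI, simp)
  finally show ?thesis .
qed

lemma word_class_closed: "w \<in> words X \<Longrightarrow> cls w \<in> carrier P"
  unfolding carrier_presented by (rule imageI)

lemma mult_word_class: "u \<in> words X \<Longrightarrow> v \<in> words X \<Longrightarrow> cls u \<otimes>\<^bsub>P\<^esub> cls v = cls (u @ v)"
  using normal.rcos_sum[OF relators_closure_normal, of "reduce u" "reduce v"]
  unfolding presented_group_def word_class_def free_group_simps mult_FactGroup
  by (simp only: reduce_in_reduced_words reduce_append_reduce reduce_reduce)

lemma one_presented: "\<one>\<^bsub>P\<^esub> = cls []"
proof -
  have "relators_closure X E #>\<^bsub>free_group X\<^esub> [] = relators_closure X E"
    using group.coset_mult_one[OF group_free_group
        subgroup.subset[OF normal_imp_subgroup[OF relators_closure_normal]]] by simp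
  then show ?thesis by (simp add: presented_group_def word_class_def)
qed

lemma inv_word_class: "w \<in> words X \<Longrightarrow> inv\<^bsub>P\<^esub> cls w = cls (inv_word w)"
  by (rule group.inv_equality[OF group_presented])
    (auto simp: mult_word_class one_presented word_class_closed intro!: word_class_cong)

lemma word_class_eq_iff:
  assumes "u \<in> words X" and "v \<in> words X"
  shows "cls u = cls v \<longleftrightarrow> reduce (u @ inv_word v) \<in> relators_closure X E"
proof -
  let ?F = "free_group X" and ?N = "relators_closure X E"
  have N: "subgroup ?N ?F"
    by (rule normal_imp_subgroup[OF relators_closure_normal])
  have u: "reduce u \<in> carrier ?F" and v: "reduce v \<in> carrier ?F"
    using assms by (simp_all add: reduce_in_reduced_words)
  have "cls u = cls v \<longleftrightarrow> reduce u \<in> ?N #>\<^bsub>?F\<^esub> reduce v"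
    unfolding word_class_def
    using group.repr_independence[OF group_free_group _ v N]
      group.rcos_self[OF group_free_group u N] by blast
  also have "\<dots> \<longleftrightarrow> reduce u \<otimes>\<^bsub>?F\<^esub> inv\<^bsub>?F\<^esub> reduce v \<in> ?N"
    by (rule subgroup.rcos_module[OF N group_free_group v u])
  also have "reduce u \<otimes>\<^bsub>?F\<^esub> inv\<^bsub>?F\<^esub> reduce v = reduce (u @ inv_word (reduce v))"
    using v by (simp add: inv_free_group)
  also have "\<dots> = reduce (u @ inv_word v)"
    by (intro reduce_append_cong reduce_inv_word_cong) simp_all
  finally show ?thesis .
qed

lemma word_class_relation:
  assumes "(u, v) \<in> E"
  shows "cls u = cls v"
proof -
  have "reduce (u @ inv_word v) \<in> conjugated_relators"
    using assms unfolding conjugated_relators_def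
    by (intro CollectI exI[of _ "[]"] exI[of _ u] exI[of _ v]) simp
  then show ?thesis
    using assms relations_in_words
    by (subst word_class_eq_iff) (auto simp: relators_closure_eq intro: generate.incl)
qed

text \<open>A subgroup generated by classes of words is the image of a free group.\<close>

lemma generate_word_classes:
  assumes \<tau>: "\<And>y. y \<in> Y \<Longrightarrow> \<tau> y \<in> words X"
  shows "generate P ((\<lambda>y. cls (\<tau> y)) ` Y) = (\<lambda>w. cls (word_subst \<tau> w)) ` words Y"
    (is "?L = ?R")
proof
  have closed: "word_subst \<tau> w \<in> words X" if "w \<in> words Y" for w
    using that \<tau> by (rule word_subst_in_words)
  show "?L \<subseteq> ?R"
  proof
    fix g assume "g \<in> ?L"
    then show "g \<in> ?R"
    proof (induction g rule: generate.induct)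
      case one
      then show ?case by (intro image_eqI[of _ _ "[]"]) (simp_all add: one_presented)
    next
      case (incl h)
      then obtain y where "y \<in> Y" "h = cls (\<tau> y)" by auto
      then show ?case by (intro image_eqI[of _ _ "[pos y]"]) simp_all
    next
      case (inv h)
      then obtain y where "y \<in> Y" "h = cls (\<tau> y)" by auto
      then show ?case by (intro image_eqI[of _ _ "[neg y]"]) (simp_all add: inv_word_class \<tau>)
    next
      case (eng g h)
      then obtain u v where "u \<in> words Y" "v \<in> words Y"
        "g = cls (word_subst \<tau> u)" "h = cls (word_subst \<tau> v)" by auto
      then show ?case
        by (intro image_eqI[of _ _ "u @ v"]) (simp_all add: mult_word_class closed)
    qed
  qed
  have "cls (word_subst \<tau> w) \<in> ?L" if "w \<in> words Y" for w
    using that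
  proof (induction w)
    case Nil
    then show ?case using generate.one[of P] by (simp add: one_presented)
  next
    case (Cons a w)
    obtain y b where a: "a = (y, b)" by (cases a)
    have y: "y \<in> Y" and w: "w \<in> words Y" using Cons.prems a by auto
    have "cls (if b then \<tau> y else inv_word (\<tau> y)) \<in> ?L"
      using y generate.incl[of "cls (\<tau> y)" _ P] generate.inv[of "cls (\<tau> y)" _ P]
      by (auto simp: inv_word_class \<tau>)
    from generate.eng[OF this Cons.IH[OF w]] show ?case
      using y w \<tau> by (auto simp: a mult_word_class closed split: if_splits)
  qed
  then show "?R \<subseteq> ?L" by auto
qed

end

text \<open>
  Von Dyck's theorem for actions: permutations \<open>act a\<close> of a set, with \<open>act a\<^sup>-\<^sup>1\<close> inverse to
  \<open>act a\<close>, define a right action of the presented group as soon as they satisfy its relations. It is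
  used below to tell elements of the group apart.
\<close>

locale letter_action =
  fixes X :: "'a set" and \<Omega> :: "'x set" and act :: "'a \<times> bool \<Rightarrow> 'x \<Rightarrow> 'x"
  assumes act_closed: "fst a \<in> X \<Longrightarrow> x \<in> \<Omega> \<Longrightarrow> act a x \<in> \<Omega>"
    and act_inverse: "fst a \<in> X \<Longrightarrow> x \<in> \<Omega> \<Longrightarrow> act (inv_letter a) (act a x) = x"
begin

lemma fold_act_closed: "w \<in> words X \<Longrightarrow> x \<in> \<Omega> \<Longrightarrow> fold act w x \<in> \<Omega>"
  by (induction w arbitrary: x) (auto simp: act_closed)

lemma fold_act_reduce:
  "w \<in> words X \<Longrightarrow> x \<in> \<Omega> \<Longrightarrow> fold act (reduce w) x = fold act w x"
proof (induction w arbitrary: x)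
  case (Cons a w)
  have "fold act (cancel_cons a (reduce w)) x = fold act (reduce w) (act a x)"
    using Cons.prems by (cases "reduce w") (auto simp: act_inverse)
  then show ?case using Cons by (simp add: act_closed)
qed simp

lemma fold_act_inverse:
  "w \<in> words X \<Longrightarrow> x \<in> \<Omega> \<Longrightarrow> fold act (inv_word w) (fold act w x) = x"
  using fold_act_reduce[of "w @ inv_word w" x] by simp

lemma fold_act_word_class:
  assumes "E \<subseteq> words X \<times> words X"
    and relation: "\<And>u v x. (u, v) \<in> E \<Longrightarrow> x \<in> \<Omega> \<Longrightarrow> fold act u x = fold act v x"
    and u: "u \<in> words X" and v: "v \<in> words X" and eq: "word_class X E u = word_class X E v"
    and x: "x \<in> \<Omega>"
  shows "fold act u x = fold act v x"
proof -
  interpret presentation X E by unfold_locales fact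
  define T where "T = {w \<in> reduced_words X. \<forall>x \<in> \<Omega>. fold act w x = x}"
  have T: "reduce w \<in> T \<longleftrightarrow> (\<forall>x \<in> \<Omega>. fold act w x = x)" if "w \<in> words X" for w
    using that by (auto simp: T_def reduce_in_reduced_words fold_act_reduce)
  have inv_T: "reduce (inv_word w) \<in> T" if "w \<in> T" for w
    using that fold_act_inverse[of w] by (subst T) (auto simp: T_def)
  \<comment> \<open>The inverse of \<open>g\<close> undoes \<open>g\<close> because \<open>r\<close> followed by the inverse of \<open>s\<close> fixes every point.\<close>
  have gen: "conjugated_relators \<subseteq> T"
  proof
    fix w assume "w \<in> conjugated_relators"
    then obtain g r s where w: "w = reduce (g @ r @ inv_word s @ inv_word g)"
      and g: "g \<in> words X" and rs: "(r, s) \<in> E"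
      by (auto simp: conjugated_relators_def)
    have r: "r \<in> words X" and s: "s \<in> words X" using rs relations_in_words by auto
    show "w \<in> T"
      unfolding w
    proof (subst T)
      show "\<forall>x \<in> \<Omega>. fold act (g @ r @ inv_word s @ inv_word g) x = x"
        using g r s rs
        by (auto simp: relation[OF rs] fold_act_closed fold_act_inverse)
    qed (use g r s in simp)
  qed
  have "w \<in> T" if "w \<in> relators_closure X E" for w
    using that unfolding relators_closure_eq
  proof (induction w rule: generate.induct)
    case one
    then show ?case by (simp add: T_def)
  next
    case (incl h)
    then show ?case using gen by auto
  next
    case (inv h)
    then have "h \<in> T" using gen by auto
    then show ?case using inv_T[of h] by (simp add: T_def inv_free_group)
  next
    case (eng g h)
    then have "g \<in> reduced_words X" "h \<in> reduced_words X" by (simp_all add: T_def)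
    then show ?case using eng by (simp add: T) (simp add: T_def)
  qed
  then have "reduce (u @ inv_word v) \<in> T"
    using eq u v by (simp add: word_class_eq_iff)
  then have "fold act (inv_word v) (fold act u x) = x"
    using x u v T[of "u @ inv_word v"] by simp
  then show ?thesis
    using fold_act_inverse[of "inv_word v" "fold act u x"] u v x by (simp add: fold_act_closed)
qed

end

section \<open>The normal form of the Miller group\<close>

locale miller =
  fixes n m :: nat and R :: "nat \<Rightarrow> nat letters"
  assumes finite_presentation: "finite_presentation n m R"
begin

abbreviation "gens \<equiv> miller_gens n m"
abbreviation "TD \<equiv> gens_TD n m"
abbreviation "Sq \<equiv> gens_Sq n"
abbreviation "rels \<equiv> miller_relations n m R"
abbreviation "G \<equiv> miller_group n m R"
abbreviation "elt \<equiv> miller_elt n m R"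

lemma gens_eq: "gens = TD \<union> Sq"
  by (auto simp: miller_gens_def gens_TD_def gens_Sq_def gens_S_def)

lemma TD_Sq_disjoint: "x \<in> TD \<Longrightarrow> x \<notin> Sq"
  by (auto simp: gens_TD_def gens_Sq_def gens_S_def)

lemma gens_S_subset: "gens_S n \<subseteq> Sq"
  by (auto simp: gens_Sq_def)

lemma words_gens [simp]: "w \<in> words TD \<Longrightarrow> w \<in> words gens" "w \<in> words Sq \<Longrightarrow> w \<in> words gens"
  by (auto simp: in_words_iff gens_eq)

lemma fst_in_gens [simp]: "x \<in> TD \<Longrightarrow> x \<in> gens" "x \<in> Sq \<Longrightarrow> x \<in> gens"
  by (auto simp: gens_eq)

lemma s_word_in_words: "i \<in> {1..m} \<Longrightarrow> s_word R i \<in> words (gens_S n)"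
  using finite_presentation
  by (force simp: finite_presentation_def s_word_def in_words_iff gens_S_def)

text \<open>
  Every defining relation says how a generator from \<open>T \<union> D\<close> conjugates a generator of \<open>F(S, q)\<close>.
  For a letter \<open>a\<close> over \<open>T \<union> D\<close>, positive or negative, this word represents \<open>a\<^sup>-\<^sup>1 x a\<close> in \<open>G(H)\<close>.
\<close>

definition conj_image :: "miller_gen \<times> bool \<Rightarrow> miller_gen \<Rightarrow> miller_gen letters" where
  "conj_image a x = (case (fst a, x) of
     (Gt i, Gq) \<Rightarrow> pos Gq # (if snd a then s_word R i else inv_word (s_word R i))
   | (Gd j, Gq) \<Rightarrow> [(Gs j, \<not> snd a), pos Gq, (Gs j, snd a)]
   | _ \<Rightarrow> [pos x])"

lemma conj_image_simps [simp]:
  "conj_image (Gt i, b) Gq = pos Gq # (if b then s_word R i else inv_word (s_word R i))"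
  "conj_image (Gd j, b) Gq = [(Gs j, \<not> b), pos Gq, (Gs j, b)]"
  "conj_image a (Gs j) = [pos (Gs j)]"
  by (simp_all add: conj_image_def split: miller_gen.split)

lemma conj_image_in_words:
  assumes "fst a \<in> TD" and "x \<in> Sq"
  shows "conj_image a x \<in> words Sq"
  using assms words_mono[OF gens_S_subset s_word_in_words]
  by (cases a) (auto simp: gens_TD_def gens_Sq_def gens_S_def)

lemma word_subst_conj_image_S: "w \<in> words (gens_S n) \<Longrightarrow> word_subst (conj_image a) w = w"
  by (rule word_subst_pos) (auto simp: gens_S_def)

lemma word_subst_conj_image_in_words:
  "fst a \<in> TD \<Longrightarrow> f \<in> words Sq \<Longrightarrow> word_subst (conj_image a) f \<in> words Sq"
  by (rule word_subst_in_words) (auto simp: conj_image_in_words)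

text \<open>
  The substitutions of \<open>a\<close> and \<open>a\<^sup>-\<^sup>1\<close> are inverse automorphisms of \<open>F(S, q)\<close>, because
  \<open>R\<^sub>i\<close> and \<open>s\<^sub>j\<close> are fixed by all of them.
\<close>

lemma conj_image_inverse:
  assumes "fst a \<in> TD" and "x \<in> Sq"
  shows "reduce (word_subst (conj_image (inv_letter a)) (conj_image a x)) = [pos x]"
proof -
  have cancel: "reduce (pos Gq # inv_word v @ v) = [pos Gq]"
    "reduce (pos Gq # v @ inv_word v) = [pos Gq]" for v
    using reduce_cancel_middle[of "[pos Gq]" v "[]"] by simp_all
  obtain y b where a: "a = (y, b)" by (cases a)
  consider "y \<in> Gt ` {1..m}" | "y \<in> Gd ` {1..n}" using assms a by (auto simp: gens_TD_def)
  then show ?thesis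
  proof cases
    case 1
    then show ?thesis
      using assms cancel s_word_in_words
      by (auto simp: a gens_Sq_def gens_S_def[of n] word_subst_inv_word word_subst_conj_image_S
          simp del: reduce_simps(2))
        (auto simp: reduce_simps(2))
  next
    case 2
    then show ?thesis using assms by (auto simp: a gens_Sq_def gens_S_def)
  qed
qed

lemma reduce_word_subst_conj_image_inverse:
  assumes "fst a \<in> TD" and "f \<in> words Sq"
  shows "reduce (word_subst (conj_image (inv_letter a)) (word_subst (conj_image a) f)) = reduce f"
proof -
  have "reduce (word_subst (conj_image (inv_letter a)) (word_subst (conj_image a) f))
      = reduce (word_subst (\<lambda>x. [pos x]) f)"
    unfolding word_subst_word_subst
    using assms by (intro reduce_word_subst_cong[of Sq]) (simp_all add: conj_image_inverse)
  also have "word_subst (\<lambda>x. [pos x]) f = f"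
    using assms(2) by (intro word_subst_pos[of Sq]) simp_all
  finally show ?thesis .
qed

lemma relations_eq:
  "rels = {([neg y, pos x, pos y], conj_image (pos y) x) | y x. y \<in> TD \<and> x \<in> Sq}"
proof
  show "rels \<subseteq> {([neg y, pos x, pos y], conj_image (pos y) x) | y x. y \<in> TD \<and> x \<in> Sq}"
    by (fastforce simp: miller_relations_def gens_TD_def gens_Sq_def gens_S_def)
  show "{([neg y, pos x, pos y], conj_image (pos y) x) | y x. y \<in> TD \<and> x \<in> Sq} \<subseteq> rels"
    by (auto simp: miller_relations_def gens_TD_def gens_Sq_def gens_S_def)
qed

sublocale presentation gens rels
proof
  show "rels \<subseteq> words gens \<times> words gens"
    unfolding relations_eq using conj_image_in_words by auto
qed

lemmas group_G = group_presented[folded miller_group_def]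
lemmas elt_cong = word_class_cong[folded miller_elt_def]
lemmas elt_closed = word_class_closed[folded miller_elt_def miller_group_def]
lemmas mult_elt = mult_word_class[folded miller_elt_def miller_group_def]
lemmas inv_elt = inv_word_class[folded miller_elt_def miller_group_def]
lemmas one_elt = one_presented[folded miller_elt_def miller_group_def]
lemmas elt_relation = word_class_relation[folded miller_elt_def]

lemma elt_reduce [simp]: "elt (reduce w) = elt w"
  by (rule elt_cong) simp

lemma carrier_G: "carrier G = elt ` words gens"
  by (simp add: miller_group_def carrier_presented miller_elt_def image_def)

lemma generate_elts:
  assumes "\<And>y. y \<in> Y \<Longrightarrow> \<tau> y \<in> words gens"
  shows "generate G ((\<lambda>y. elt (\<tau> y)) ` Y) = (\<lambda>w. elt (word_subst \<tau> w)) ` words Y"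
  using generate_word_classes[of Y \<tau>] assms by (simp add: miller_group_def miller_elt_def)

lemma subgroup_of_gens_eq:
  assumes "Y \<subseteq> gens"
  shows "subgroup_of_gens n m R Y = elt ` words Y"
  unfolding subgroup_of_gens_def
  using assms generate_elts[of Y "\<lambda>y. [pos y]"]
  by (auto simp: word_subst_pos[of Y] intro!: image_cong)

lemma F_Sq_eq: "F_Sq n m R = elt ` words Sq" and F_TD_eq: "F_TD n m R = elt ` words TD"
  unfolding F_Sq_def F_TD_def by (intro subgroup_of_gens_eq; simp add: gens_eq)+

lemma elt_append_cong:
  assumes "elt u = elt u'" and "elt v = elt v'"
    and "u \<in> words gens" "u' \<in> words gens" "v \<in> words gens" "v' \<in> words gens"
  shows "elt (u @ v) = elt (u' @ v')"
  using assms by (simp flip: mult_elt)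

subsection \<open>Existence of the normal form\<close>

text \<open>
  Conjugation and substitution are both multiplicative, so they need to agree on generators only.
\<close>

lemma elt_conj_extend:
  assumes a: "fst a \<in> TD"
    and gen: "\<And>x. x \<in> Sq \<Longrightarrow> elt [inv_letter a, pos x, a] = elt (conj_image a x)"
    and f: "f \<in> words Sq"
  shows "elt (inv_letter a # f @ [a]) = elt (word_subst (conj_image a) f)"
  using f
proof (induction f)
  case Nil
  show ?case by (rule elt_cong) simp
next
  case (Cons c f)
  obtain x b where c: "c = (x, b)" by (cases c)
  have x: "x \<in> Sq" and f: "f \<in> words Sq" using Cons.prems c by auto
  have neg: "elt [inv_letter a, neg x, a] = elt (inv_word (conj_image a x))"
    using gen[OF x] a x inv_elt[of "[inv_letter a, pos x, a]"] inv_elt[of "conj_image a x"]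
    by (simp add: conj_image_in_words)
  have "elt (inv_letter a # c # f @ [a])
      = elt ([inv_letter a, c, a] @ (inv_letter a # f @ [a]))"
    using reduce_cancel_middle(1)[of "[inv_letter a, c]" "[a]" "f @ [a]"]
    by (intro elt_cong) simp
  also have "\<dots> = elt ((if b then conj_image a x else inv_word (conj_image a x))
      @ word_subst (conj_image a) f)"
    using a x f c neg gen[OF x] Cons.IH
    by (intro elt_append_cong)
      (auto simp: conj_image_in_words word_subst_conj_image_in_words)
  finally show ?case by (simp add: c)
qed

text \<open>
  The relations provide the equality on generators if \<open>a\<close> is positive. If \<open>a\<close> is the inverse of
  \<open>y\<close>, conjugation by \<open>y\<close> takes the word \<open>conj_image a x\<close> to \<open>x\<close>, because the substitutions are
  inverse to each other; so the conjugate of \<open>x\<close> by \<open>a\<close> is that word.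
\<close>

lemma elt_conj:
  assumes a: "fst a \<in> TD" and f: "f \<in> words Sq"
  shows "elt (inv_letter a # f @ [a]) = elt (word_subst (conj_image a) f)"
proof -
  have positive: "elt (neg y # h @ [pos y]) = elt (word_subst (conj_image (pos y)) h)"
    if y: "y \<in> TD" and h: "h \<in> words Sq" for y h
  proof -
    have "elt [neg y, pos x, pos y] = elt (conj_image (pos y) x)" if "x \<in> Sq" for x
      using y that by (intro elt_relation) (auto simp: relations_eq)
    then show ?thesis using elt_conj_extend[of "pos y" h] y h by simp
  qed
  obtain y b where a_eq: "a = (y, b)" by (cases a)
  show ?thesis
  proof (cases b)
    case True
    then show ?thesis using positive[of y f] a f by (simp add: a_eq)
  next
    case False
    have "elt [pos y, pos x, neg y] = elt (conj_image (neg y) x)" if x: "x \<in> Sq" for x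
    proof -
      let ?w = "conj_image (neg y) x"
      have y: "y \<in> TD" and w: "?w \<in> words Sq"
        using a x by (simp_all add: a_eq conj_image_in_words)
      have "elt (neg y # ?w @ [pos y]) = elt (word_subst (conj_image (pos y)) ?w)"
        using positive y w by simp
      also have "\<dots> = elt [pos x]"
        using conj_image_inverse[of "neg y" x] x y by (intro elt_cong) simp
      finally have *: "elt (neg y # ?w @ [pos y]) = elt [pos x]" .
      have "elt ?w = elt ([pos y] @ ((neg y # ?w @ [pos y]) @ [neg y]))"
        using reduce_cancel_middle(1)[of "[]" "[pos y]" "?w @ [pos y, neg y]"]
          reduce_cancel_middle(1)[of ?w "[pos y]" "[]"]
        by (intro elt_cong) simp
      also have "\<dots> = elt ([pos y] @ ([pos x] @ [neg y]))"
        using * x y w by (intro elt_append_cong) auto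
      finally show ?thesis by simp
    qed
    then show ?thesis using elt_conj_extend[of a f] a f False by (simp add: a_eq)
  qed
qed

text \<open>
  The effect of right multiplication by a letter on the pair \<open>(u, f)\<close> that stands for \<open>u f\<close>:
  a letter \<open>a\<close> from \<open>T \<union> D\<close> moves to the left across \<open>f\<close> by \<open>u f a = (u a) (a\<^sup>-\<^sup>1 f a)\<close>.
\<close>

definition nf_act ::
    "miller_gen \<times> bool \<Rightarrow> miller_gen letters \<times> miller_gen letters
      \<Rightarrow> miller_gen letters \<times> miller_gen letters" where
  "nf_act a = (\<lambda>(u, f). if fst a \<in> TD
     then (reduce (u @ [a]), reduce (word_subst (conj_image a) f)) else (u, reduce (f @ [a])))"

abbreviation "NF \<equiv> reduced_words TD \<times> reduced_words Sq"

sublocale nf: letter_action gens NF nf_act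
proof
  fix a :: "miller_gen \<times> bool" and x assume a: "fst a \<in> gens" and "x \<in> NF"
  then obtain u f where x: "x = (u, f)" and u: "u \<in> reduced_words TD"
    and f: "f \<in> reduced_words Sq" by auto
  show "nf_act a x \<in> NF"
    using a u f
    by (auto simp: nf_act_def x gens_eq word_subst_conj_image_in_words
        intro!: reduce_in_reduced_words)
  show "nf_act (inv_letter a) (nf_act a x) = x"
  proof (cases "fst a \<in> TD")
    case True
    then show ?thesis
      using u f reduce_cancel_middle(1)[of u "[a]" "[]"]
      by (simp add: nf_act_def x reduce_word_subst_conj_image_inverse)
  next
    case False
    then show ?thesis
      using f reduce_cancel_middle(1)[of f "[a]" "[]"] by (simp add: nf_act_def x)
  qed
qed

lemma elt_fold_nf_act:
  assumes "w \<in> words gens" and "(u, f) \<in> NF" and "fold nf_act w (u, f) = (u', f')"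
  shows "elt (u @ f @ w) = elt (u' @ f')"
  using assms
proof (induction w arbitrary: u f)
  case (Cons a w)
  obtain u1 f1 where act: "nf_act a (u, f) = (u1, f1)" by (cases "nf_act a (u, f)")
  have nf1: "(u1, f1) \<in> NF" using nf.act_closed[of a "(u, f)"] Cons.prems act by simp
  have w: "w \<in> words gens" using Cons.prems by simp
  have step: "elt (u @ f @ [a]) = elt (u1 @ f1)"
  proof (cases "fst a \<in> TD")
    case True
    have "elt (u @ f @ [a]) = elt ((u @ [a]) @ (inv_letter a # f @ [a]))"
      using reduce_cancel_middle(1)[of u "[a]" "f @ [a]"] by (intro elt_cong) simp
    also have "\<dots> = elt (u1 @ f1)"
    proof (rule elt_append_cong)
      have u1: "u1 = reduce (u @ [a])" and f1: "f1 = reduce (word_subst (conj_image a) f)"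
        using True act by (simp_all add: nf_act_def)
      show "elt (u @ [a]) = elt u1" by (simp add: u1)
      show "elt (inv_letter a # f @ [a]) = elt f1"
        using True Cons.prems by (simp add: f1 elt_conj)
    qed (use True Cons.prems nf1 in simp_all)
    finally show ?thesis .
  next
    case False
    then show ?thesis
      using Cons.prems act by (intro elt_cong) (auto simp: nf_act_def)
  qed
  have "elt ((u @ f @ [a]) @ w) = elt ((u1 @ f1) @ w)"
    using step Cons.prems nf1
    by (intro elt_append_cong[of "u @ f @ [a]" "u1 @ f1"]) simp_all
  also have "\<dots> = elt (u' @ f')"
    using Cons.IH[OF w nf1] Cons.prems act by simp
  finally show ?case by simp
qed simp

subsection \<open>Uniqueness of the normal form\<close>

lemma fold_nf_act_Sq:
  assumes "w \<in> words Sq" and "f \<in> reduced_words Sq"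
  shows "fold nf_act w (u, f) = (u, reduce (f @ w))"
  using assms
proof (induction w arbitrary: f)
  case (Cons a w)
  then show ?case
    using TD_Sq_disjoint[of "fst a"] by (auto simp: nf_act_def reduce_in_reduced_words)
qed simp

lemma fold_nf_act_TD:
  assumes "w \<in> words TD" and "u \<in> reduced_words TD"
  shows "fold nf_act w (u, []) = (reduce (u @ w), [])"
  using assms
proof (induction w arbitrary: u)
  case (Cons a w)
  then show ?case by (auto simp: nf_act_def reduce_in_reduced_words)
qed simp

text \<open>
  In a relation for \<open>y\<^sup>-\<^sup>1 z y\<close>, the letters \<open>y\<^sup>-\<^sup>1\<close> and \<open>y\<close> cancel in the first component; in the
  second one their substitutions cancel on \<open>f\<close>, and only that of \<open>y\<close> is applied to \<open>z\<close>. By Von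
  Dyck's theorem the action is therefore defined on the Miller group, and the image of the empty
  pair under an element is its normal form.
\<close>

lemma fold_nf_act_relation:
  assumes "(r, s) \<in> rels" and "x \<in> NF"
  shows "fold nf_act r x = fold nf_act s x"
proof -
  obtain y z where r: "r = [neg y, pos z, pos y]" and s: "s = conj_image (pos y) z"
    and y: "y \<in> TD" and z: "z \<in> Sq" using assms(1) by (auto simp: relations_eq)
  obtain u f where x: "x = (u, f)" and u: "u \<in> reduced_words TD" and f: "f \<in> reduced_words Sq"
    using assms(2) by auto
  have z': "z \<notin> TD" using z TD_Sq_disjoint by auto
  have "reduce (word_subst (conj_image (pos y)) (word_subst (conj_image (neg y)) f)
      @ conj_image (pos y) z) = reduce (f @ conj_image (pos y) z)"
    using reduce_word_subst_conj_image_inverse[of "neg y" f] y f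
    by (intro reduce_append_cong) simp_all
  then have "fold nf_act r x = (u, reduce (f @ s))"
    using y z' u reduce_cancel_middle(2)[of u "[pos y]" "[]"]
    by (simp add: r s x nf_act_def)
  then show ?thesis
    using fold_nf_act_Sq[of s f u] f y z by (simp add: s x conj_image_in_words)
qed

lemma fold_nf_act_elt:
  "u \<in> words gens \<Longrightarrow> v \<in> words gens \<Longrightarrow> elt u = elt v \<Longrightarrow> x \<in> NF \<Longrightarrow>
    fold nf_act u x = fold nf_act v x"
  unfolding miller_elt_def
  by (rule nf.fold_act_word_class[OF relations_in_words fold_nf_act_relation])

text \<open>Acting on the empty pair recovers a normal form from the element that it represents.\<close>

lemma fold_nf_act_normal_form: "(u, f) \<in> NF \<Longrightarrow> fold nf_act (u @ f) ([], []) = (u, f)"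
  using fold_nf_act_TD[of u "[]"] fold_nf_act_Sq[of f "[]" u] by auto

lemma bij_betw_normal_form: "bij_betw (\<lambda>(u, f). elt (u @ f)) NF (carrier G)"
proof (rule bij_betw_imageI)
  show "inj_on (\<lambda>(u, f). elt (u @ f)) NF"
  proof (rule inj_onI)
    fix x y assume x: "x \<in> NF" and y: "y \<in> NF"
      and eq: "(case x of (u, f) \<Rightarrow> elt (u @ f)) = (case y of (u, f) \<Rightarrow> elt (u @ f))"
    obtain u f v h where xy: "x = (u, f)" "y = (v, h)" by (cases x, cases y)
    have "fold nf_act (u @ f) ([], []) = fold nf_act (v @ h) ([], [])"
      using x y eq xy by (intro fold_nf_act_elt) auto
    then show "x = y" using fold_nf_act_normal_form x y xy by metis
  qed
  show "(\<lambda>(u, f). elt (u @ f)) ` NF = carrier G"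
  proof
    show "(\<lambda>(u, f). elt (u @ f)) ` NF \<subseteq> carrier G" by (auto intro!: elt_closed)
    show "carrier G \<subseteq> (\<lambda>(u, f). elt (u @ f)) ` NF"
    proof
      fix g assume "g \<in> carrier G"
      then obtain w where w: "w \<in> words gens" "g = elt w" by (auto simp: carrier_G)
      obtain u f where uf: "fold nf_act w ([], []) = (u, f)"
        by (cases "fold nf_act w ([], [])")
      then have "(u, f) \<in> NF" using nf.fold_act_closed[of w "([], [])"] w by simp
      moreover have "g = elt (u @ f)" using elt_fold_nf_act[of w "[]" "[]" u f] uf w by simp
      ultimately show "g \<in> (\<lambda>(u, f). elt (u @ f)) ` NF" by force
    qed
  qed
qed

lemma elt_normal_form_eq:
  "(u, f) \<in> NF \<Longrightarrow> (v, h) \<in> NF \<Longrightarrow> elt (u @ f) = elt (v @ h) \<Longrightarrow> u = v \<and> f = h"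
  using inj_onD[OF bij_betw_imp_inj_on[OF bij_betw_normal_form], of "(u, f)" "(v, h)"] by simp

lemma free_length_elt:
  assumes "Y = TD \<or> Y = Sq" and w: "w \<in> reduced_words Y"
  shows "free_length n m R Y (elt w) = length w"
proof -
  have unique: "v = w" if "v \<in> words Y" "freely_reduced v" "elt v = elt w" for v
  proof -
    have "v \<in> reduced_words Y" using that unfolding reduced_words_def by simp
    then show ?thesis
      using that assms elt_normal_form_eq[of v "[]" w "[]"] elt_normal_form_eq[of "[]" v "[]" w]
      by auto
  qed
  show ?thesis
    unfolding free_length_def
  proof (rule the_equality)
    show "\<exists>v \<in> words Y. freely_reduced v \<and> elt v = elt w \<and> length v = length w"
      using w unfolding reduced_words_def by auto
  qed (use unique in auto)
qed

lemma miller_length_elt: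
  assumes "(u, f) \<in> NF"
  shows "miller_length n m R (elt (u @ f)) = length u + length f"
  unfolding miller_length_def
proof (rule the_equality)
  have "elt u \<otimes>\<^bsub>G\<^esub> elt f = elt (u @ f)" using assms by (simp add: mult_elt)
  then show "\<exists>u' \<in> F_TD n m R. \<exists>f' \<in> F_Sq n m R. elt (u @ f) = u' \<otimes>\<^bsub>G\<^esub> f' \<and>
      length u + length f = free_length n m R TD u' + free_length n m R Sq f'"
    using assms
    by (intro bexI[of _ "elt u"] bexI[of _ "elt f"])
      (simp_all add: free_length_elt F_TD_eq F_Sq_eq)
next
  fix r assume "\<exists>u' \<in> F_TD n m R. \<exists>f' \<in> F_Sq n m R. elt (u @ f) = u' \<otimes>\<^bsub>G\<^esub> f' \<and>
      r = free_length n m R TD u' + free_length n m R Sq f'"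
  then obtain v h where v: "v \<in> words TD" and h: "h \<in> words Sq"
    and eq: "elt (u @ f) = elt v \<otimes>\<^bsub>G\<^esub> elt h"
    and r: "r = free_length n m R TD (elt v) + free_length n m R Sq (elt h)"
    by (auto simp: F_TD_eq F_Sq_eq)
  have nf: "(reduce v, reduce h) \<in> NF" using v h by (simp add: reduce_in_reduced_words)
  have "elt (u @ f) = elt (reduce v @ reduce h)"
    unfolding eq using v h by (simp add: mult_elt) (rule elt_cong, simp)
  then have "u = reduce v" "f = reduce h" using elt_normal_form_eq[OF assms nf] by auto
  moreover have "elt v = elt (reduce v)" "elt h = elt (reduce h)" by simp_all
  ultimately show "r = length u + length f"
    using r nf free_length_elt[of TD "reduce v"] free_length_elt[of Sq "reduce h"] by simp
qed

section \<open>The Strong Black Hole\<close>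

definition td_part :: "miller_gen letters \<Rightarrow> miller_gen letters" where
  "td_part w = filter (\<lambda>a. fst a \<in> TD) w"

lemma td_part_simps [simp]:
  "td_part [] = []" "td_part (a # w) = (if fst a \<in> TD then a # td_part w else td_part w)"
  "td_part (u @ v) = td_part u @ td_part v"
  by (simp_all add: td_part_def)

lemma td_part_inv_word: "td_part (inv_word w) = inv_word (td_part w)"
  by (induction w) auto

lemma td_part_Sq: "w \<in> words Sq \<Longrightarrow> td_part w = []"
  using TD_Sq_disjoint by (induction w) auto

lemma fst_fold_nf_act:
  "x \<in> NF \<Longrightarrow> w \<in> words gens \<Longrightarrow> fst (fold nf_act w x) = reduce (fst x @ td_part w)"
proof (induction w arbitrary: x)
  case (Cons a w)
  have "fst (fold nf_act w (nf_act a x)) = reduce (fst (nf_act a x) @ td_part w)"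
    using Cons nf.act_closed[of a x] by simp
  moreover have "fst (nf_act a x) = reduce (fst x @ (if fst a \<in> TD then [a] else []))"
    using Cons.prems by (auto simp: nf_act_def)
  ultimately show ?case by simp
qed auto

text \<open>
  Deleting the letters from \<open>S \<union> {q}\<close> is the projection of \<open>G(H)\<close> onto \<open>F(T, D)\<close>; this is how
  \<open>F(S, q)\<close> is seen to be normal.
\<close>

lemma elt_in_F_Sq_iff:
  assumes w: "w \<in> words gens"
  shows "elt w \<in> F_Sq n m R \<longleftrightarrow> reduce (td_part w) = []"
proof
  have nf0: "([], []) \<in> NF" by simp
  show "reduce (td_part w) = []" if "elt w \<in> F_Sq n m R"
  proof -
    obtain f where f: "f \<in> words Sq" "elt w = elt f" using \<open>elt w \<in> F_Sq n m R\<close>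
      by (auto simp: F_Sq_eq)
    then show ?thesis
      using fold_nf_act_elt[of w f "([], [])"] w fst_fold_nf_act[OF nf0 w]
        fst_fold_nf_act[OF nf0, of f] by (simp add: td_part_Sq)
  qed
  show "elt w \<in> F_Sq n m R" if "reduce (td_part w) = []"
  proof -
    obtain u f where uf: "fold nf_act w ([], []) = (u, f)" by (cases "fold nf_act w ([], [])")
    have "u = []" using that fst_fold_nf_act[OF nf0 w] uf by simp
    moreover have "f \<in> reduced_words Sq" using nf.fold_act_closed[OF w nf0] uf by simp
    ultimately show ?thesis using elt_fold_nf_act[OF w nf0 uf] by (simp add: F_Sq_eq)
  qed
qed

lemma F_Sq_conj:
  assumes x: "x \<in> carrier G" and g: "g \<in> F_Sq n m R"
  shows "x \<otimes>\<^bsub>G\<^esub> g \<otimes>\<^bsub>G\<^esub> inv\<^bsub>G\<^esub> x \<in> F_Sq n m R"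
proof -
  obtain w where w: "w \<in> words gens" "x = elt w" using x by (auto simp: carrier_G)
  obtain f where f: "f \<in> words Sq" "g = elt f" using g by (auto simp: F_Sq_eq)
  have "x \<otimes>\<^bsub>G\<^esub> g \<otimes>\<^bsub>G\<^esub> inv\<^bsub>G\<^esub> x = elt (w @ f @ inv_word w)"
    using w f by (simp add: inv_elt mult_elt)
  then show ?thesis
    using w f by (simp add: elt_in_F_Sq_iff td_part_inv_word td_part_Sq)
qed

lemma F_Sq_subset: "F_Sq n m R \<subseteq> carrier G"
  by (auto simp: F_Sq_eq intro: elt_closed)

lemma strong_black_hole_subset: "strong_black_hole n m R \<subseteq> F_Sq n m R"
proof
  fix h assume "h \<in> strong_black_hole n m R"
  then obtain x g where "x \<in> carrier G" "h = x \<otimes>\<^bsub>G\<^esub> g \<otimes>\<^bsub>G\<^esub> inv\<^bsub>G\<^esub> x"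
    and g: "strongly_singular n m R g"
    by (auto simp: strong_black_hole_def)
  moreover have "g \<in> F_Sq n m R"
    using g F_Sq_subset group.is_monoid[OF group_G]
    by (auto simp: strongly_singular_def monoid.l_one)
  ultimately show "h \<in> F_Sq n m R" by (simp add: F_Sq_conj)
qed

text \<open>
  Elements of \<open>F(S, q)\<close> have trivial \<open>F(T, D)\<close>-component, so for them strong singularity amounts to
  being cyclically reduced.
\<close>

lemma strong_black_holeI:
  assumes "cyclically_reduced n m R g" and "g \<in> F_Sq n m R"
  shows "g \<in> strong_black_hole n m R"
proof -
  interpret G: group G by (rule group_G)
  have g: "g \<in> carrier G" using assms(2) F_Sq_subset by auto
  have one: "\<one>\<^bsub>G\<^esub> \<in> F_TD n m R" by (auto simp: F_TD_eq one_elt)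
  have "strongly_singular n m R g"
    unfolding strongly_singular_def using assms g one by force
  then show ?thesis
    unfolding strong_black_hole_def using g by (intro CollectI exI[of _ "\<one>\<^bsub>G\<^esub>"] exI[of _ g]) simp
qed

subsection \<open>Powers of a generator of the given group\<close>

text \<open>
  Each generator of the associated subgroups projects to a free generator of \<open>F(T, D)\<close> or its
  inverse, so that these subgroups are mapped isomorphically onto \<open>F(T, D)\<close> and meet the kernel
  \<open>F(S, q)\<close> trivially. The words \<open>r i\<close> are empty for \<open>A\<close> and equal to \<open>R\<^sub>i\<close> for \<open>B\<close>.
\<close>

lemma associated_subgroup_Int_F_Sq:
  assumes r: "\<And>i. i \<in> {1..m} \<Longrightarrow> r i \<in> words (gens_S n)"
    and g: "g \<in> generate G ({elt (pos (Gt i) # inv_word (r i)) | i. i \<in> {1..m}} \<union>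
      {elt [pos (Gs j), neg (Gd j)] | j. j \<in> {1..n}})" (is "g \<in> generate G ?A")
    and "g \<in> F_Sq n m R"
  shows "g = \<one>\<^bsub>G\<^esub>"
proof -
  \<comment> \<open>The generator \<open>s\<^sub>j d\<^sub>j\<^sup>-\<^sup>1\<close> is replaced by its inverse, which projects to \<open>d\<^sub>j\<close> itself.\<close>
  define \<tau> where "\<tau> y = (case y of Gt i \<Rightarrow> pos (Gt i) # inv_word (r i)
    | Gd j \<Rightarrow> [pos (Gd j), neg (Gs j)] | _ \<Rightarrow> [])" for y
  have r': "r i \<in> words Sq" if "i \<in> {1..m}" for i
    using words_mono[OF gens_S_subset r] that by simp
  have Gs: "Gs j \<in> Sq" if "j \<in> {1..n}" for j using that by (auto simp: gens_Sq_def gens_S_def)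
  have \<tau>_words: "\<tau> y \<in> words gens" if "y \<in> TD" for y
    using that r' Gs fst_in_gens by (auto simp: \<tau>_def gens_TD_def)
  have \<tau>_part: "td_part (\<tau> y) = [pos y]" if "y \<in> TD" for y
    using that r' td_part_Sq Gs TD_Sq_disjoint
    by (auto simp: \<tau>_def td_part_inv_word gens_TD_def)
  let ?B = "generate G ((\<lambda>y. elt (\<tau> y)) ` TD)"
  have "subgroup ?B G"
    using \<tau>_words by (intro group.generate_is_subgroup[OF group_G]) (auto intro!: elt_closed)
  moreover have "?A \<subseteq> ?B"
  proof -
    have "elt (pos (Gt i) # inv_word (r i)) \<in> ?B" if "i \<in> {1..m}" for i
      using that by (intro generate.incl image_eqI[of _ _ "Gt i"]) (auto simp: \<tau>_def gens_TD_def)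
    moreover have "elt [pos (Gs j), neg (Gd j)] \<in> ?B" if j: "j \<in> {1..n}" for j
    proof -
      have Gd: "Gd j \<in> TD" using j by (auto simp: gens_TD_def)
      have "inv\<^bsub>G\<^esub> elt (\<tau> (Gd j)) = elt [pos (Gs j), neg (Gd j)]"
        using inv_elt[OF \<tau>_words[OF Gd]] by (simp add: \<tau>_def)
      then show ?thesis
        using generate.inv[of "elt (\<tau> (Gd j))" "(\<lambda>y. elt (\<tau> y)) ` TD" G] Gd by auto
    qed
    ultimately show ?thesis by auto
  qed
  ultimately have "g \<in> ?B"
    using g group.generate_subgroup_incl[OF group_G] by blast
  then obtain w where w: "w \<in> words TD" "g = elt (word_subst \<tau> w)"
    using generate_elts[of TD \<tau>] \<tau>_words by auto
  have "td_part (word_subst \<tau> w) = w"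
    using w(1) \<tau>_part by (induction w) (auto simp: td_part_inv_word)
  moreover have "word_subst \<tau> w \<in> words gens"
    using word_subst_in_words[OF w(1) \<tau>_words] .
  ultimately have "reduce w = []"
    using \<open>g \<in> F_Sq n m R\<close> w elt_in_F_Sq_iff[of "word_subst \<tau> w"] by simp
  then have "reduce (word_subst \<tau> w) = reduce []"
    using reduce_word_subst[of \<tau> w] by simp
  then show ?thesis
    unfolding w one_elt by (rule elt_cong)
qed

lemma hnn_A_Int_F_Sq: "g \<in> hnn_A n m R \<Longrightarrow> g \<in> F_Sq n m R \<Longrightarrow> g = \<one>\<^bsub>G\<^esub>"
  using associated_subgroup_Int_F_Sq[of "\<lambda>_. []" g] by (simp add: hnn_A_def)

lemma hnn_B_Int_F_Sq: "g \<in> hnn_B n m R \<Longrightarrow> g \<in> F_Sq n m R \<Longrightarrow> g = \<one>\<^bsub>G\<^esub>"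
  using associated_subgroup_Int_F_Sq[of "s_word R" g] s_word_in_words by (simp add: hnn_B_def)

text \<open>
  A nontrivial element of \<open>F(S)\<close> lies in the base \<open>K\<close> of the HNN-extension, and its conjugates
  stay in \<open>F(S, q)\<close>, hence outside \<open>A\<close> and \<open>B\<close>.
\<close>

lemma F_S_subset_strong_black_hole:
  assumes w: "w \<in> words (gens_S n)" and "reduce w \<noteq> []"
  shows "elt w \<in> strong_black_hole n m R"
proof (rule strong_black_holeI)
  interpret G: group G by (rule group_G)
  have w': "w \<in> words Sq" using words_mono[OF gens_S_subset w] .
  then have nf: "([], reduce w) \<in> NF" by (simp add: reduce_in_reduced_words)
  show F: "elt w \<in> F_Sq n m R" using w' by (simp add: F_Sq_eq)
  have closed: "elt w \<in> carrier G" using F F_Sq_subset by auto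
  have nontrivial: "elt w \<noteq> \<one>\<^bsub>G\<^esub>"
    using elt_normal_form_eq[OF nf, of "[]" "[]"] assms(2) by (auto simp: one_elt)
  have base: "hnn_base n m R = elt ` words (TD \<union> gens_S n)"
    unfolding hnn_base_def using gens_S_subset
    by (intro subgroup_of_gens_eq) (auto simp: gens_eq)
  have "\<not> (\<exists>k \<in> hnn_base n m R. k \<otimes>\<^bsub>G\<^esub> elt w \<otimes>\<^bsub>G\<^esub> inv\<^bsub>G\<^esub> k \<in> hnn_A n m R \<union> hnn_B n m R)"
  proof
    assume "\<exists>k \<in> hnn_base n m R. k \<otimes>\<^bsub>G\<^esub> elt w \<otimes>\<^bsub>G\<^esub> inv\<^bsub>G\<^esub> k \<in> hnn_A n m R \<union> hnn_B n m R"
    then obtain v where v: "v \<in> words (TD \<union> gens_S n)"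
      and conj: "elt v \<otimes>\<^bsub>G\<^esub> elt w \<otimes>\<^bsub>G\<^esub> inv\<^bsub>G\<^esub> elt v \<in> hnn_A n m R \<union> hnn_B n m R"
      by (auto simp: base)
    have "TD \<union> gens_S n \<subseteq> gens" using gens_S_subset by (auto simp: gens_eq)
    then have k: "elt v \<in> carrier G" using words_mono[OF _ v] by (intro elt_closed)
    have one: "elt v \<otimes>\<^bsub>G\<^esub> elt w \<otimes>\<^bsub>G\<^esub> inv\<^bsub>G\<^esub> elt v = \<one>\<^bsub>G\<^esub>"
      using conj F_Sq_conj[OF k F] hnn_A_Int_F_Sq hnn_B_Int_F_Sq by blast
    have "elt v \<otimes>\<^bsub>G\<^esub> elt w = elt v \<otimes>\<^bsub>G\<^esub> elt w \<otimes>\<^bsub>G\<^esub> inv\<^bsub>G\<^esub> elt v \<otimes>\<^bsub>G\<^esub> elt v"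
      using k closed by (simp add: G.m_assoc)
    also have "\<dots> = elt v \<otimes>\<^bsub>G\<^esub> \<one>\<^bsub>G\<^esub>" using one k by simp
    finally have "elt w = \<one>\<^bsub>G\<^esub>" using k closed by (simp del: G.r_one)
    then show False using nontrivial by simp
  qed
  moreover have "elt w \<in> hnn_base n m R"
    unfolding base using words_mono[OF _ w, of "TD \<union> gens_S n"] by auto
  ultimately show "cyclically_reduced n m R (elt w)"
    using closed unfolding cyclically_reduced_def hnn_cyclically_reduced_def by blast
qed

subsection \<open>Powers of the stable letter for an empty set of generators\<close>

text \<open>
  If \<open>n = 0\<close>, then \<open>F(S)\<close> is trivial, and the remaining candidates are the powers of \<open>q\<close>; they are cyclically
  reduced by the condition on \<open>\<lambda>\<close>, which is computed from the exponent sum of \<open>q\<close>.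
\<close>

definition q_exponent :: "miller_gen letters \<Rightarrow> int" where
  "q_exponent w = (\<Sum>a\<leftarrow>w. if fst a = Gq then (if snd a then 1 else -1) else 0)"

lemma q_exponent_simps [simp]:
  "q_exponent [] = 0" "q_exponent (u @ v) = q_exponent u + q_exponent v"
  "q_exponent (a # w) = (if fst a = Gq then (if snd a then 1 else -1) else 0) + q_exponent w"
  by (simp_all add: q_exponent_def)

lemma q_exponent_0: "w \<in> words X \<Longrightarrow> Gq \<notin> X \<Longrightarrow> q_exponent w = 0"
  by (induction w) auto

text \<open>
  The defining relations preserve the exponent sum, so by Von Dyck's theorem the group acts on the
  integers with \<open>q\<close> as the translation by 1 and all other generators trivial.
\<close>

lemma q_exponent_elt:
  assumes "u \<in> words gens" and "v \<in> words gens" and "elt u = elt v"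
  shows "q_exponent u = q_exponent v"
proof -
  define act where
    "act a x = x + (if fst a = Gq then (if snd a then 1 else -1) else 0)"
    for a :: "miller_gen \<times> bool" and x :: int
  interpret letter_action gens UNIV act
    by unfold_locales (auto simp: act_def)
  have fold: "fold act w x = x + q_exponent w" for w x
    by (induction w arbitrary: x) (auto simp: act_def)
  have Gq: "Gq \<notin> gens_S n" by (auto simp: gens_S_def)
  have relation: "q_exponent r = q_exponent s" if rs: "(r, s) \<in> rels" for r s
  proof -
    have "q_exponent (s_word R i) = 0" if "i \<in> {1..m}" for i
      by (rule q_exponent_0[OF s_word_in_words[OF that] Gq])
    then show ?thesis using rs by (auto simp: miller_relations_def)
  qed
  have "fold act u 0 = fold act v 0"
    by (rule fold_act_word_class[OF relations_in_words])
      (use assms in \<open>simp_all only: fold relation miller_elt_def UNIV_I\<close>)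
  then show ?thesis by (simp add: fold)
qed

text \<open>Elements of the base are products of letters other than \<open>q\<close>, hence have exponent sum 0.\<close>

lemma hnn_value_q_exponent:
  assumes "k\<^sub>0 \<in> hnn_base n m R" and "\<forall>(e, k) \<in> set ps. e \<in> {1, -1} \<and> k \<in> hnn_base n m R"
  shows "\<exists>w \<in> words gens. hnn_value G (elt [pos Gq]) k\<^sub>0 ps = elt w \<and>
    q_exponent w = (\<Sum>(e, k)\<leftarrow>ps. e)"
proof -
  interpret G: group G by (rule group_G)
  have Gq: "Gq \<in> gens" by (simp add: miller_gens_def)
  have "TD \<union> gens_S n \<subseteq> gens" using gens_S_subset by (auto simp: gens_eq)
  then have base: "\<exists>v \<in> words gens. k = elt v \<and> q_exponent v = 0" if "k \<in> hnn_base n m R" for k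
    using that q_exponent_0[of _ "TD \<union> gens_S n"] words_mono[of "TD \<union> gens_S n" gens]
    by (auto simp: hnn_base_def subgroup_of_gens_eq gens_TD_def gens_S_def)
  have "\<exists>w \<in> words gens. foldr (\<lambda>(e, k) x. elt [pos Gq] [^]\<^bsub>G\<^esub> e \<otimes>\<^bsub>G\<^esub> k \<otimes>\<^bsub>G\<^esub> x) ps \<one>\<^bsub>G\<^esub> = elt w \<and>
      q_exponent w = (\<Sum>(e, k)\<leftarrow>ps. e)"
    using assms(2)
  proof (induction ps)
    case Nil
    then show ?case by (intro bexI[of _ "[]"]) (simp_all add: one_elt)
  next
    case (Cons p ps)
    obtain e k where p: "p = (e, k)" by (cases p)
    obtain v where v: "v \<in> words gens" "k = elt v" "q_exponent v = 0"
      using base Cons.prems p by auto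
    obtain w where w: "w \<in> words gens" "q_exponent w = (\<Sum>(e, k)\<leftarrow>ps. e)"
      "foldr (\<lambda>(e, k) x. elt [pos Gq] [^]\<^bsub>G\<^esub> e \<otimes>\<^bsub>G\<^esub> k \<otimes>\<^bsub>G\<^esub> x) ps \<one>\<^bsub>G\<^esub> = elt w"
      using Cons by auto
    have e: "e = 1 \<or> e = -1" using Cons.prems p by auto
    then have "elt [pos Gq] [^]\<^bsub>G\<^esub> e = elt [(Gq, e = 1)]"
      using Gq elt_closed[of "[pos Gq]"] by (auto simp: G.int_pow_neg inv_elt)
    then show ?case
      using v w e Gq by (intro bexI[of _ "(Gq, e = 1) # v @ w"]) (auto simp: p mult_elt)
  qed
  then obtain w where "w \<in> words gens" "q_exponent w = (\<Sum>(e, k)\<leftarrow>ps. e)"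
    "foldr (\<lambda>(e, k) x. elt [pos Gq] [^]\<^bsub>G\<^esub> e \<otimes>\<^bsub>G\<^esub> k \<otimes>\<^bsub>G\<^esub> x) ps \<one>\<^bsub>G\<^esub> = elt w" by auto
  moreover obtain v where "v \<in> words gens" "k\<^sub>0 = elt v" "q_exponent v = 0"
    using base assms(1) by auto
  ultimately show ?thesis
    by (intro bexI[of _ "v @ w"]) (auto simp: hnn_value_def mult_elt)
qed

text \<open>
  There are no letters \<open>s\<^sub>j\<close> and the words \<open>R\<^sub>i\<close> are empty, so both associated subgroups are
  generated by \<open>T\<close>, as the base is.
\<close>

lemma hnn_base_subset:
  assumes "n = 0"
  shows "hnn_base n m R \<subseteq> hnn_A n m R" and "hnn_base n m R \<subseteq> hnn_B n m R"
proof -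
  have empty: "gens_S n = {}" and TD: "TD = Gt ` {1..m}"
    using assms by (auto simp: gens_S_def gens_TD_def)
  have "s_word R i = []" if "i \<in> {1..m}" for i
    using s_word_in_words[OF that] by (cases "s_word R i") (auto simp: empty)
  then show "hnn_base n m R \<subseteq> hnn_A n m R" "hnn_base n m R \<subseteq> hnn_B n m R"
    unfolding hnn_base_def subgroup_of_gens_def hnn_A_def hnn_B_def TD empty
    by (intro group.mono_generate[OF group_G]; force)+
qed

text \<open>
  A change of sign between neighbouring stable letters could be cancelled, since the element of the
  base between them lies in both associated subgroups. Therefore the length of a reduced form is the
  absolute value of the exponent sum.
\<close>

lemma hnn_reduced_exponents:
  assumes "hnn_reduced K A B k\<^sub>0 ps" and "K \<subseteq> A" and "K \<subseteq> B"
  shows "\<exists>c \<in> {1, -1}. \<forall>(e, k) \<in> set ps. e = c"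
  using assms(1)
proof (induction ps)
  case (Cons p ps)
  obtain e k where p: "p = (e, k)" by (cases p)
  have e: "e \<in> {1, -1}" and k: "k \<in> A" "k \<in> B"
    using Cons.prems assms(2,3) by (auto simp: hnn_reduced_def p)
  have "hnn_reduced K A B k\<^sub>0 ps"
    using Cons.prems by (auto simp: hnn_reduced_def successively_Cons)
  then obtain c where c: "c \<in> {1, -1}" "\<forall>(e, k) \<in> set ps. e = c" using Cons.IH by auto
  show ?case
  proof (cases ps)
    case Nil
    then show ?thesis using e p by auto
  next
    case (Cons p' ps')
    obtain e' k' where p': "p' = (e', k')" by (cases p')
    have "e' = c" using c Cons p' by auto
    moreover have "e = e'"
      using Cons.prems e k c \<open>e' = c\<close> by (auto simp: hnn_reduced_def Cons p p')
    ultimately show ?thesis using c p by auto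
  qed
qed auto

lemma hnn_length_q_power:
  assumes "n = 0"
  shows "hnn_length G (hnn_base n m R) (hnn_A n m R) (hnn_B n m R) (elt [pos Gq])
    (elt (replicate k (pos Gq))) = k"
  unfolding hnn_length_def
proof (rule the_equality)
  interpret G: group G by (rule group_G)
  have Gq: "Gq \<in> gens" by (simp add: miller_gens_def)
  have words: "replicate i (pos Gq) \<in> words gens" for i using Gq by (simp add: in_words_iff)
  have one: "\<one>\<^bsub>G\<^esub> \<in> hnn_base n m R"
    unfolding hnn_base_def subgroup_of_gens_def by (rule generate.one)
  let ?ps = "replicate k (1 :: int, \<one>\<^bsub>G\<^esub>)"
  have "successively (\<lambda>(e, k) (e', k'). \<not> (e = -1 \<and> k \<in> hnn_A n m R \<and> e' = 1) \<and>
      \<not> (e = 1 \<and> k \<in> hnn_B n m R \<and> e' = -1)) ?ps"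
    by (induction k) (auto simp: successively_Cons)
  then have "hnn_reduced (hnn_base n m R) (hnn_A n m R) (hnn_B n m R) \<one>\<^bsub>G\<^esub> ?ps"
    using one by (auto simp: hnn_reduced_def)
  moreover have "foldr (\<lambda>(e, k) x. elt [pos Gq] [^]\<^bsub>G\<^esub> (e :: int) \<otimes>\<^bsub>G\<^esub> k \<otimes>\<^bsub>G\<^esub> x) ?ps \<one>\<^bsub>G\<^esub>
      = elt (replicate k (pos Gq))"
    using Gq words by (induction k) (simp_all add: one_elt elt_closed mult_elt)
  then have "hnn_value G (elt [pos Gq]) \<one>\<^bsub>G\<^esub> ?ps = elt (replicate k (pos Gq))"
    using elt_closed[OF words] by (simp add: hnn_value_def)
  ultimately show "\<exists>k\<^sub>0 ps. hnn_reduced (hnn_base n m R) (hnn_A n m R) (hnn_B n m R) k\<^sub>0 ps \<and>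
      hnn_value G (elt [pos Gq]) k\<^sub>0 ps = elt (replicate k (pos Gq)) \<and> length ps = k"
    by (intro exI conjI) auto
  fix r assume "\<exists>k\<^sub>0 ps. hnn_reduced (hnn_base n m R) (hnn_A n m R) (hnn_B n m R) k\<^sub>0 ps \<and>
      hnn_value G (elt [pos Gq]) k\<^sub>0 ps = elt (replicate k (pos Gq)) \<and> length ps = r"
  then obtain k\<^sub>0 ps where red: "hnn_reduced (hnn_base n m R) (hnn_A n m R) (hnn_B n m R) k\<^sub>0 ps"
    and eq: "hnn_value G (elt [pos Gq]) k\<^sub>0 ps = elt (replicate k (pos Gq))"
    and r: "length ps = r" by auto
  obtain w where w: "w \<in> words gens" "hnn_value G (elt [pos Gq]) k\<^sub>0 ps = elt w"
    "q_exponent w = (\<Sum>(e, k)\<leftarrow>ps. e)"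
    using red hnn_value_q_exponent[of k\<^sub>0 ps] by (auto simp: hnn_reduced_def)
  have "(\<Sum>(e, k)\<leftarrow>ps. e) = q_exponent (replicate k (pos Gq))"
    using q_exponent_elt[OF w(1) words] w eq by simp
  also have "\<dots> = int k" by (induction k) auto
  finally have sum: "(\<Sum>(e, k)\<leftarrow>ps. e) = int k" .
  obtain c where c: "c \<in> {1, -1}" "\<forall>(e, k) \<in> set ps. e = c"
    using hnn_reduced_exponents[OF red hnn_base_subset[OF assms]] by auto
  have "(\<Sum>(e, k)\<leftarrow>ps. e) = c * int (length ps)"
    using c(2) by (induction ps) (auto simp: algebra_simps)
  then show "r = k" using sum c(1) r by auto
qed

lemma q_power_in_strong_black_hole:
  assumes "n = 0" and "k > 0"
  shows "elt (replicate k (pos Gq)) \<in> strong_black_hole n m R"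
proof (rule strong_black_holeI)
  have Sq: "replicate k (pos Gq) \<in> words Sq" by (simp add: in_words_iff gens_Sq_def)
  then show F: "elt (replicate k (pos Gq)) \<in> F_Sq n m R" by (simp add: F_Sq_eq)
  have "elt (replicate k (pos Gq)) \<otimes>\<^bsub>G\<^esub> elt (replicate k (pos Gq))
      = elt (replicate (2 * k) (pos Gq))"
    using Sq by (simp add: mult_elt mult_2 flip: replicate_add)
  moreover have "elt (replicate k (pos Gq)) \<in> carrier G" using F F_Sq_subset by auto
  ultimately show "cyclically_reduced n m R (elt (replicate k (pos Gq)))"
    unfolding cyclically_reduced_def hnn_cyclically_reduced_def
    using assms(2) by (simp add: hnn_length_q_power[OF assms(1)])
qed

text \<open>The witnesses are the powers of \<open>s\<^sub>1\<close> for \<open>n > 0\<close> and the powers of \<open>q\<close> for \<open>n = 0\<close>.\<close>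

lemma strong_black_hole_Int_sphere_nonempty:
  assumes "k > 0"
  shows "strong_black_hole n m R \<inter> sphere G (miller_length n m R) k \<noteq> {}"
proof -
  define x where "x = (if n = 0 then Gq else Gs 1)"
  let ?w = "replicate k (pos x)"
  have x: "x \<in> Sq" by (auto simp: x_def gens_Sq_def gens_S_def)
  have "freely_reduced ?w"
    unfolding freely_reduced_def by (induction k) (auto simp: successively_Cons inv_letter_def)
  then have w: "?w \<in> reduced_words Sq" and red: "reduce ?w = ?w"
    using x unfolding reduced_words_def by (auto simp: in_words_iff reduce_id)
  have "elt ?w \<in> strong_black_hole n m R"
  proof (cases "n = 0")
    case True
    then show ?thesis using q_power_in_strong_black_hole assms by (simp add: x_def)
  next
    case False
    then have "?w \<in> words (gens_S n)" by (auto simp: x_def in_words_iff gens_S_def)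
    then show ?thesis using F_S_subset_strong_black_hole[of ?w] red assms by simp
  qed
  moreover have "elt ?w \<in> sphere G (miller_length n m R) k"
    using miller_length_elt[of "[]" ?w] w by (simp add: sphere_def elt_closed)
  ultimately show ?thesis by auto
qed

section \<open>Frequencies\<close>

lemma card_TD: "card TD = n + m" and finite_TD: "finite TD"
proof -
  have "card TD = card (Gt ` {1..m}) + card (Gd ` {1..n})"
    unfolding gens_TD_def by (intro card_Un_disjoint) auto
  then show "card TD = n + m" by (simp add: card_image inj_on_def)
qed (simp add: gens_TD_def)

lemma card_Sq: "card Sq = n + 1" and finite_Sq: "finite Sq"
proof -
  have "card (Gs ` {1..n}) = n" by (simp add: card_image inj_on_def)
  then show "card Sq = n + 1"
    unfolding gens_Sq_def gens_S_def by (subst card_insert_disjoint) auto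
qed (simp add: gens_Sq_def gens_S_def)

abbreviation "G_sphere k \<equiv> sphere G (miller_length n m R) k"

lemma sphere_eq:
  "G_sphere k = (\<lambda>(u, f). elt (u @ f)) ` {(u, f) \<in> NF. length u + length f = k}"
proof
  show "G_sphere k \<subseteq> (\<lambda>(u, f). elt (u @ f)) ` {(u, f) \<in> NF. length u + length f = k}"
  proof
    fix g assume g: "g \<in> G_sphere k"
    then have "g \<in> (\<lambda>(u, f). elt (u @ f)) ` NF"
      using bij_betw_imp_surj_on[OF bij_betw_normal_form] by (simp add: sphere_def)
    then obtain u f where uf: "(u, f) \<in> NF" "g = elt (u @ f)" by auto
    then have "length u + length f = k" using g miller_length_elt[OF uf(1)] by (simp add: sphere_def)
    then show "g \<in> (\<lambda>(u, f). elt (u @ f)) ` {(u, f) \<in> NF. length u + length f = k}"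
      using uf by (intro image_eqI[of _ _ "(u, f)"]) auto
  qed
  show "(\<lambda>(u, f). elt (u @ f)) ` {(u, f) \<in> NF. length u + length f = k} \<subseteq> G_sphere k"
    by (auto simp: sphere_def miller_length_elt elt_closed)
qed

lemma finite_sphere: "finite (G_sphere k)"
proof -
  have "{(u, f) \<in> NF. length u + length f = k}
      \<subseteq> (\<Union>i \<in> {..k}. reduced_words_of_length TD i) \<times> (\<Union>i \<in> {..k}. reduced_words_of_length Sq i)"
    by (auto simp: reduced_words_of_length_def)
  then have "finite {(u, f) \<in> NF. length u + length f = k}"
    by (rule finite_subset)
      (simp add: finite_reduced_words_of_length finite_TD finite_Sq)
  then show ?thesis unfolding sphere_eq by (rule finite_imageI)
qed

text \<open>
  Counting only the normal forms with a trivial factor suffices: the words over \<open>T \<union> D\<close> alone give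
  the required rate of growth, and the words over \<open>S \<union> {q}\<close>, being at least one, make the final
  estimate strict.
\<close>

lemma card_sphere_ge:
  assumes "k > 0"
  shows "card (reduced_words_of_length TD k) + card (reduced_words_of_length Sq k)
    \<le> card (G_sphere k)"
proof -
  let ?U = "reduced_words_of_length TD k \<times> {[]}" and ?F = "{[]} \<times> reduced_words_of_length Sq k"
  let ?N = "{(u, f) \<in> NF. length u + length f = k}"
  have sub: "?U \<union> ?F \<subseteq> ?N" by (auto simp: reduced_words_of_length_def)
  have inj: "inj_on (\<lambda>(u, f). elt (u @ f)) ?N"
    by (rule inj_on_subset[OF bij_betw_imp_inj_on[OF bij_betw_normal_form]]) auto
  have finite: "finite ?N"
    using finite_sphere finite_image_iff[OF inj] by (simp add: sphere_eq)
  have "card (reduced_words_of_length TD k) + card (reduced_words_of_length Sq k) = card (?U \<union> ?F)"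
    using assms finite_reduced_words_of_length[OF finite_TD] finite_reduced_words_of_length[OF finite_Sq]
    by (subst card_Un_disjoint) (auto simp: card_cartesian_product reduced_words_of_length_def)
  also have "\<dots> \<le> card ?N" using finite sub by (rule card_mono)
  also have "\<dots> = card (G_sphere k)" unfolding sphere_eq using inj by (simp add: card_image)
  finally show ?thesis .
qed

lemma card_strong_black_hole_Int_sphere_le:
  "card (strong_black_hole n m R \<inter> G_sphere k) \<le> card (reduced_words_of_length Sq k)"
proof -
  have "strong_black_hole n m R \<inter> G_sphere k \<subseteq> elt ` reduced_words_of_length Sq k"
  proof
    fix g assume g: "g \<in> strong_black_hole n m R \<inter> G_sphere k"
    then obtain w where w: "w \<in> words Sq" "g = elt (reduce w)"
      using strong_black_hole_subset by (auto simp: F_Sq_eq)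
    then have "reduce w \<in> reduced_words_of_length Sq k"
      using g miller_length_elt[of "[]" "reduce w"]
      by (simp add: reduced_words_of_length_def sphere_def reduce_in_reduced_words)
    then show "g \<in> elt ` reduced_words_of_length Sq k" using w(2) by (rule rev_image_eqI)
  qed
  then have "card (strong_black_hole n m R \<inter> G_sphere k) \<le> card (elt ` reduced_words_of_length Sq k)"
    by (intro card_mono) (simp_all add: finite_reduced_words_of_length finite_Sq)
  also have "\<dots> \<le> card (reduced_words_of_length Sq k)"
    by (intro card_image_le) (simp add: finite_reduced_words_of_length finite_Sq)
  finally show ?thesis .
qed

text \<open>
  With the ranks \<open>p = n + 1\<close> and \<open>r = n + m\<close>, the quotient of the two sphere sizes is
  \<open>(p/r) ((2p - 1)/(2r - 1))\<^sup>k\<^sup>-\<^sup>1\<close>, and \<open>(2p - 1)/(2r - 1) < p/r\<close> because \<open>p < r\<close>.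
\<close>

lemma frequency_strong_black_hole:
  assumes "m > 1" and "k > 0"
  shows "0 < frequency G (miller_length n m R) (strong_black_hole n m R) k"
    and "frequency G (miller_length n m R) (strong_black_hole n m R) k
      < (real (n + 1) / real (n + m)) ^ k"
proof -
  obtain j where k: "k = Suc j" using assms(2) by (cases k) auto
  let ?a = "card (strong_black_hole n m R \<inter> G_sphere k)" and ?b = "card (G_sphere k)"
  let ?p = "card (reduced_words_of_length Sq k)" and ?r = "card (reduced_words_of_length TD k)"
  have a: "?a > 0"
    using strong_black_hole_Int_sphere_nonempty[OF assms(2)] finite_sphere by (simp add: card_gt_0_iff)
  have ap: "?a \<le> ?p" by (rule card_strong_black_hole_Int_sphere_le)
  have b: "?r + ?p \<le> ?b" by (rule card_sphere_ge[OF assms(2)])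
  have p: "real ?p = 2 * real (n + 1) * (2 * real (n + 1) - 1) ^ j"
    using card_reduced_words_of_length[OF finite_Sq] by (simp add: k card_Sq algebra_simps)
  have r: "real ?r = 2 * real (n + m) * (2 * real (n + m) - 1) ^ j"
    using card_reduced_words_of_length[OF finite_TD] assms(1) by (simp add: k card_TD of_nat_diff)
  have r_pos: "real ?r > 0" unfolding r using assms(1) by (intro mult_pos_pos zero_less_power) auto
  show "0 < frequency G (miller_length n m R) (strong_black_hole n m R) k"
    using a ap b by (simp add: frequency_def)
  have "frequency G (miller_length n m R) (strong_black_hole n m R) k = real ?a / real ?b"
    by (simp add: frequency_def)
  also have "\<dots> < real ?p / real ?r"
    using a ap b r_pos by (intro frac_less2) auto
  also have "\<dots> = real (n + 1) / real (n + m) * ((2 * real (n + 1) - 1) / (2 * real (n + m) - 1)) ^ j"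
  proof -
    have "2 * x * y / (2 * z * w) = x / z * (y / w)" for x y z w :: real by simp
    then show ?thesis unfolding p r power_divide .
  qed
  also have "\<dots> \<le> real (n + 1) / real (n + m) * (real (n + 1) / real (n + m)) ^ j"
    using assms(1) by (intro mult_left_mono power_mono) (auto simp: divide_simps algebra_simps)
  finally show "frequency G (miller_length n m R) (strong_black_hole n m R) k
      < (real (n + 1) / real (n + m)) ^ k"
    by (simp add: k)
qed

lemma frequency_complement:
  assumes "k > 0"
  shows "frequency G (miller_length n m R) (carrier G - strong_black_hole n m R) k
    = 1 - frequency G (miller_length n m R) (strong_black_hole n m R) k"
proof -
  let ?S = "strong_black_hole n m R \<inter> G_sphere k"
  have "(carrier G - strong_black_hole n m R) \<inter> G_sphere k = G_sphere k - ?S"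
    by (auto simp: sphere_def)
  then have "card ((carrier G - strong_black_hole n m R) \<inter> G_sphere k) = card (G_sphere k) - card ?S"
    using finite_sphere by (simp add: card_Diff_subset)
  moreover have "card ?S \<le> card (G_sphere k)" by (intro card_mono finite_sphere) auto
  moreover have "card (G_sphere k) > 0"
    using strong_black_hole_Int_sphere_nonempty[OF assms] finite_sphere by (auto simp: card_gt_0_iff)
  ultimately show ?thesis
    by (simp add: frequency_def of_nat_diff diff_divide_distrib)
qed

lemma strongly_negligible_strong_black_hole:
  assumes "m > 1"
  shows "strongly_negligible G (miller_length n m R) (strong_black_hole n m R)"
proof -
  define \<delta> where "\<delta> = real (n + 1) / real (n + m)"
  let ?c = "frequency G (miller_length n m R) (carrier G - strong_black_hole n m R)"
  have \<delta>: "0 < \<delta>" "\<delta> < 1" using assms by (simp_all add: \<delta>_def)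
  have bounds: "1 - \<delta> ^ k < ?c k \<and> ?c k < 1" if "k > 0" for k
    using frequency_strong_black_hole[OF assms that] that
    by (simp add: frequency_complement \<delta>_def)
  have ev: "\<forall>\<^sub>F k in sequentially. 1 - \<delta> ^ k < ?c k \<and> ?c k < 1"
    by (rule eventually_mono[OF eventually_gt_at_top[of 0]]) (rule bounds)
  have "?c \<longlonglongrightarrow> 1"
  proof (rule tendsto_sandwich)
    show "(\<lambda>k. 1 - \<delta> ^ k) \<longlonglongrightarrow> 1"
      using tendsto_diff[OF tendsto_const[of 1] LIMSEQ_power_zero[of \<delta>]] \<delta> by simp
    show "\<forall>\<^sub>F k in sequentially. 1 - \<delta> ^ k \<le> ?c k" "\<forall>\<^sub>F k in sequentially. ?c k \<le> 1"
      using ev by (auto elim: eventually_mono)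
  qed simp
  then have "(\<lambda>k. ereal (?c k)) \<longlonglongrightarrow> 1" by (simp add: one_ereal_def)
  then have "limsup (\<lambda>k. ereal (?c k)) = 1" by (intro lim_imp_Limsup) simp_all
  then show ?thesis
    unfolding strongly_negligible_def strongly_generic_def generic_set_def using ev \<delta> by blast
qed

end

theorem theorem5p1:
  fixes n m :: nat and R :: "nat \<Rightarrow> nat letters"
  assumes "finite_presentation n m R" and "m > 1"
  shows "strongly_negligible (miller_group n m R) (miller_length n m R) (strong_black_hole n m R)
    \<and> (\<forall>k > 1. frequency (miller_group n m R) (miller_length n m R) (strong_black_hole n m R) k
          < (real (n + 1) / real (n + m)) ^ (k - 1))"
proof (intro conjI allI impI)
  interpret miller n m R by unfold_locales (rule assms(1))
  show "strongly_negligible (miller_group n m R) (miller_length n m R) (strong_black_hole n m R)"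
    by (rule strongly_negligible_strong_black_hole[OF assms(2)])
  fix k :: nat assume "k > 1"
  then have "frequency (miller_group n m R) (miller_length n m R) (strong_black_hole n m R) k
      < (real (n + 1) / real (n + m)) ^ k"
    by (intro frequency_strong_black_hole(2)[OF assms(2)]) simp
  also have "\<dots> \<le> (real (n + 1) / real (n + m)) ^ (k - 1)"
    using assms(2) by (intro power_decreasing) simp_all
  finally show "frequency (miller_group n m R) (miller_length n m R) (strong_black_hole n m R) k
      < (real (n + 1) / real (n + m)) ^ (k - 1)" .
qed

end
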